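(* Let $D$ denote the countable universal directed graph. (i) Let $\Gamma$ be a countable (undirected) graph. Then there exist $2^{\aleph_0}$ distinct regular $\mathscr{D}$-classes of $\operatorname{End} D$ whose group $\mathscr{H}$-classes are isomorphic to $\operatorname{Aut}\Gamma$. (ii) Every regular $\mathscr{D}$-class of $\operatorname{End} D$ contains $2^{\aleph_0}$ distinct group $\mathscr{H}$-classes.
   Context: A graph is a pair $(V,E)$ with $E$ an irreflexive symmetric binary relation on $V$; a directed graph is a pair $(V,E)$ with $E$ an irreflexive binary relation on $V$. The countable universal directed graph $D$ is the Fraïssé limit of the class of finite directed graphs (the unique countable existentially closed directed graph). $\operatorname{End} D$ is the monoid of endomorphisms (maps $f$ on vertices with $(uf,vf)\in E$ whenever $(u,v)\in E$), maps written on the right, $fg$ = first $f$ then $g$. Green's relations on a monoid $M$: $f\,\mathscr{L}\,g$ iff $Mf=Mg$; $f\,\mathscr{R}\,g$ iff $fM=gM$; $\mathscr{H}=\mathscr{L}\cap\mathscr{R}$; $\mathscr{D}=\mathscr{L}\circ\mathscr{R}$. An element $f$ is regular if $fgf=f$ for some $g\in M$; a regular $\mathscr{D}$-class consists of regular elements. A group $\mathscr{H}$-class is the $\mathscr{H}$-class of an idempotent (a maximal subgroup of $M$). *)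

theory Defs
  imports "HOL-Algebra.Coset" "HOL-Library.Countable_Set" "HOL-Library.Equipollence"
begin

definition digraph :: "'a set \<Rightarrow> 'a rel \<Rightarrow> bool" where
  "digraph V E \<longleftrightarrow> E \<subseteq> V \<times> V \<and> irrefl E"

definition ugraph :: "'a set \<Rightarrow> 'a rel \<Rightarrow> bool" where
  "ugraph V E \<longleftrightarrow> digraph V E \<and> sym E"

definition digraph_embedding ::
    "'a set \<Rightarrow> 'a rel \<Rightarrow> 'b set \<Rightarrow> 'b rel \<Rightarrow> ('a \<Rightarrow> 'b) \<Rightarrow> bool" where
  "digraph_embedding V E W F f \<longleftrightarrow>
     f \<in> V \<rightarrow> W \<and> inj_on f V \<and> (\<forall>u\<in>V. \<forall>v\<in>V. (u, v) \<in> E \<longleftrightarrow> (f u, f v) \<in> F)"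

definition digraph_iso ::
    "'a set \<Rightarrow> 'a rel \<Rightarrow> 'b set \<Rightarrow> 'b rel \<Rightarrow> ('a \<Rightarrow> 'b) \<Rightarrow> bool" where
  "digraph_iso V E W F f \<longleftrightarrow>
     bij_betw f V W \<and> (\<forall>u\<in>V. \<forall>v\<in>V. (u, v) \<in> E \<longleftrightarrow> (f u, f v) \<in> F)"

text \<open>
  Maps are written on the right, so the product of \<open>f\<close> and \<open>g\<close> is \<open>f\<close> followed by \<open>g\<close>.
  Self-maps of \<open>V\<close> are represented by functions that are \<open>undefined\<close> outside \<open>V\<close>, which
  makes equality of maps on \<open>V\<close> coincide with equality in HOL.
\<close>

definition End_digraph :: "'a set \<Rightarrow> 'a rel \<Rightarrow> ('a \<Rightarrow> 'a) monoid" where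
  "End_digraph V E =
     \<lparr>carrier = {f \<in> V \<rightarrow>\<^sub>E V. \<forall>u\<in>V. \<forall>v\<in>V. (u, v) \<in> E \<longrightarrow> (f u, f v) \<in> E},
      mult = (\<lambda>f g. compose V g f),
      one = (\<lambda>x\<in>V. x)\<rparr>"

definition Aut_digraph :: "'a set \<Rightarrow> 'a rel \<Rightarrow> ('a \<Rightarrow> 'a) monoid" where
  "Aut_digraph V E =
     \<lparr>carrier = {f \<in> extensional V. digraph_iso V E V E f},
      mult = (\<lambda>f g. compose V g f),
      one = (\<lambda>x\<in>V. x)\<rparr>"

text \<open>
  The Fraisse limit of the class of finite directed graphs: the countable directed graph, unique
  up to isomorphism, that is homogeneous and whose age consists of all finite directed graphs.
  Every finite directed graph is isomorphic to one whose vertices are natural numbers, so it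
  suffices to embed those; conversely, finite induced subgraphs of a directed graph are
  directed graphs.
\<close>

definition universal_digraph :: "'a set \<Rightarrow> 'a rel \<Rightarrow> bool" where
  "universal_digraph V E \<longleftrightarrow>
     digraph V E \<and> countable V \<and>
     (\<forall>(W :: nat set) F. finite W \<and> digraph W F \<longrightarrow> (\<exists>f. digraph_embedding W F V E f)) \<and>
     (\<forall>A B f. finite A \<and> A \<subseteq> V \<and> B \<subseteq> V \<and> digraph_iso A (Restr E A) B (Restr E B) f
        \<longrightarrow> (\<exists>g \<in> carrier (Aut_digraph V E). \<forall>x\<in>A. g x = f x))"

definition green_L :: "('a, 'b) monoid_scheme \<Rightarrow> 'a rel" where
  "green_L M = {(f, g). f \<in> carrier M \<and> g \<in> carrier M \<and>
     carrier M #>\<^bsub>M\<^esub> f = carrier M #>\<^bsub>M\<^esub> g}"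

definition green_R :: "('a, 'b) monoid_scheme \<Rightarrow> 'a rel" where
  "green_R M = {(f, g). f \<in> carrier M \<and> g \<in> carrier M \<and>
     f <#\<^bsub>M\<^esub> carrier M = g <#\<^bsub>M\<^esub> carrier M}"

definition green_H :: "('a, 'b) monoid_scheme \<Rightarrow> 'a rel" where
  "green_H M = green_L M \<inter> green_R M"

definition green_D :: "('a, 'b) monoid_scheme \<Rightarrow> 'a rel" where
  "green_D M = green_L M O green_R M"

definition regular_elem :: "('a, 'b) monoid_scheme \<Rightarrow> 'a \<Rightarrow> bool" where
  "regular_elem M f \<longleftrightarrow> f \<in> carrier M \<and> (\<exists>g\<in>carrier M. f \<otimes>\<^bsub>M\<^esub> g \<otimes>\<^bsub>M\<^esub> f = f)"

definition idempotents :: "('a, 'b) monoid_scheme \<Rightarrow> 'a set" where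
  "idempotents M = {e \<in> carrier M. e \<otimes>\<^bsub>M\<^esub> e = e}"

definition regular_D_classes :: "('a, 'b) monoid_scheme \<Rightarrow> 'a set set" where
  "regular_D_classes M = {X \<in> carrier M // green_D M. \<forall>f\<in>X. regular_elem M f}"

definition group_H_classes :: "('a, 'b) monoid_scheme \<Rightarrow> 'a set set" where
  "group_H_classes M = {green_H M `` {e} | e. e \<in> idempotents M}"

definition H_group :: "('a, 'b) monoid_scheme \<Rightarrow> 'a \<Rightarrow> ('a, 'b) monoid_scheme" where
  "H_group M e = M\<lparr>carrier := green_H M `` {e}, one := e\<rparr>"

end

theory Submission
  imports Defs
begin

text \<open>
  The group \<open>\<H>\<close>-class of an idempotent \<open>e\<close> is the automorphism group of the digraph induced on its
  image, and two idempotents are \<open>\<D>\<close>-related iff these digraphs are isomorphic. Up to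
  isomorphism, the images are exactly the countable digraphs in which every finite set of vertices
  has a two-way common neighbour. Joining a graph completely to a rigid ray that encodes a set of
  natural numbers produces such a digraph without changing the automorphism group, which gives
  continuum many \<open>\<D>\<close>-classes; doubling the vertices of an image produces such a digraph with
  continuum many retractions onto copies of that image, which gives continuum many group
  \<open>\<H>\<close>-classes in each regular \<open>\<D>\<close>-class.
\<close>

section \<open>Green's relations\<close>

text \<open>Two-way common neighbours characterise the images for the following reason.
  Homomorphisms need not reflect non-edges, so a retraction can be built vertex by vertex: whatever
  edges the next vertex has, a two-way common neighbour of all values used so far is an admissible
  value for it. Conversely, a retraction sends a common neighbour of points that it fixes to another
  such neighbour inside the image.

  The digraph built for part (i) faces two conflicting demands: it needs a common neighbour for
  every finite set, hence plenty of two-way edges, but it may have no automorphisms beyond those of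
  the given graph. Orientation resolves the conflict. The graph is undirected and is joined to the
  ray in both directions, so the only one-way edges are those along the ray, and they make it
  recognisable. Edges are reduced only between ray vertices at distance one or two, so far out on
  the ray a vertex is still joined both ways to any given finite set.

  These constructions yield lower bounds only; the matching upper bound is the cardinality of the
  monoid itself.\<close>

context monoid
begin

text \<open>The identity puts a generator into its own principal ideal, so inclusion of ideals
  amounts to divisibility of generators. The multipliers \<open>u\<close> and \<open>v\<close> are
  what later arguments evaluate pointwise.\<close>

lemma green_L_iff:
  "(f, g) \<in> green_L G \<longleftrightarrow> f \<in> carrier G \<and> g \<in> carrier G \<and>
     (\<exists>u\<in>carrier G. f = u \<otimes> g) \<and> (\<exists>v\<in>carrier G. g = v \<otimes> f)"
proof -
  have sub: "carrier G #> f \<subseteq> carrier G #> g \<longleftrightarrow> (\<exists>u\<in>carrier G. f = u \<otimes> g)"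
    if "f \<in> carrier G" "g \<in> carrier G" for f g
  proof
    have "f \<in> carrier G #> f"
      unfolding r_coset_def using l_one[OF that(1)] by (intro UN_I[of \<one>]) simp_all
    then show "\<exists>u\<in>carrier G. f = u \<otimes> g" if "carrier G #> f \<subseteq> carrier G #> g"
      using that by (auto simp: r_coset_def)
  next
    assume "\<exists>u\<in>carrier G. f = u \<otimes> g"
    then obtain u where u: "u \<in> carrier G" "f = u \<otimes> g" by blast
    have "h \<otimes> f = (h \<otimes> u) \<otimes> g \<and> h \<otimes> u \<in> carrier G" if "h \<in> carrier G" for h
      using that u \<open>g \<in> carrier G\<close> by (simp add: m_assoc)
    then show "carrier G #> f \<subseteq> carrier G #> g"
      by (fastforce simp: r_coset_def)
  qed
  show ?thesis
    unfolding green_L_def using sub[of f g] sub[of g f] by auto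
qed

lemma green_R_iff:
  "(f, g) \<in> green_R G \<longleftrightarrow> f \<in> carrier G \<and> g \<in> carrier G \<and>
     (\<exists>u\<in>carrier G. f = g \<otimes> u) \<and> (\<exists>v\<in>carrier G. g = f \<otimes> v)"
proof -
  have sub: "f <# carrier G \<subseteq> g <# carrier G \<longleftrightarrow> (\<exists>u\<in>carrier G. f = g \<otimes> u)"
    if "f \<in> carrier G" "g \<in> carrier G" for f g
  proof
    have "f \<in> f <# carrier G"
      unfolding l_coset_def using r_one[OF that(1)] by (intro UN_I[of \<one>]) simp_all
    then show "\<exists>u\<in>carrier G. f = g \<otimes> u" if "f <# carrier G \<subseteq> g <# carrier G"
      using that by (auto simp: l_coset_def)
  next
    assume "\<exists>u\<in>carrier G. f = g \<otimes> u"
    then obtain u where u: "u \<in> carrier G" "f = g \<otimes> u" by blast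
    have "f \<otimes> h = g \<otimes> (u \<otimes> h) \<and> u \<otimes> h \<in> carrier G" if "h \<in> carrier G" for h
      using that u \<open>g \<in> carrier G\<close> by (simp add: m_assoc)
    then show "f <# carrier G \<subseteq> g <# carrier G"
      by (fastforce simp: l_coset_def)
  qed
  show ?thesis
    unfolding green_R_def using sub[of f g] sub[of g f] by auto
qed

lemma green_H_refl: "f \<in> carrier G \<Longrightarrow> (f, f) \<in> green_H G"
  by (simp add: green_H_def green_L_def green_R_def)

lemma green_D_refl: "f \<in> carrier G \<Longrightarrow> (f, f) \<in> green_D G"
  by (force simp: green_D_def green_L_def green_R_def)

lemma green_L_trans: "(f, g) \<in> green_L G \<Longrightarrow> (g, h) \<in> green_L G \<Longrightarrow> (f, h) \<in> green_L G"
  by (simp add: green_L_def)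

lemma green_R_trans: "(f, g) \<in> green_R G \<Longrightarrow> (g, h) \<in> green_R G \<Longrightarrow> (f, h) \<in> green_R G"
  by (simp add: green_R_def)

text \<open>A witness of regularity travels along both factors of \<D>: if
  \<open>f = u \<otimes> x\<close> and \<open>x = h \<otimes> a\<close>, then \<open>g\<close> for
  \<open>f\<close> becomes \<open>g \<otimes> u\<close> for \<open>x\<close> and
  \<open>a \<otimes> (g \<otimes> u)\<close> for \<open>h\<close>. Hence the \<D>-class of an
  idempotent is a regular one.\<close>

lemma green_D_regular:
  assumes "(f, h) \<in> green_D G" "regular_elem G f"
  shows "regular_elem G h"
proof -
  obtain x where x: "(f, x) \<in> green_L G" "(x, h) \<in> green_R G"
    using assms(1) by (auto simp: green_D_def)
  obtain g where g: "g \<in> carrier G" "f \<otimes> g \<otimes> f = f"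
    using assms(2) by (auto simp: regular_elem_def)
  obtain u v where uv: "u \<in> carrier G" "f = u \<otimes> x" "v \<in> carrier G" "x = v \<otimes> f"
      and [simp]: "f \<in> carrier G" "x \<in> carrier G"
    using x(1) by (auto simp: green_L_iff)
  obtain a b where ab: "a \<in> carrier G" "x = h \<otimes> a" "b \<in> carrier G" "h = x \<otimes> b"
      and [simp]: "h \<in> carrier G"
    using x(2) by (auto simp: green_R_iff)
  have "x \<otimes> (g \<otimes> u) \<otimes> x = (v \<otimes> f) \<otimes> (g \<otimes> (u \<otimes> x))"
    using uv(1,3) g(1) by (simp add: m_assoc flip: uv(4))
  also have "\<dots> = v \<otimes> (f \<otimes> g \<otimes> f)"
    using uv(1,3) g(1) by (simp add: m_assoc flip: uv(2))
  finally have xx: "x \<otimes> (g \<otimes> u) \<otimes> x = x"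
    using g(2) uv(4) by simp
  have "h \<otimes> (a \<otimes> (g \<otimes> u)) \<otimes> h = (h \<otimes> a) \<otimes> (g \<otimes> u) \<otimes> (x \<otimes> b)"
    using ab(1,3) uv(1) g(1) by (simp add: m_assoc flip: ab(4))
  also have "\<dots> = (x \<otimes> (g \<otimes> u) \<otimes> x) \<otimes> b"
    using ab(1,3) uv(1) g(1) by (simp add: m_assoc flip: ab(2))
  finally have "h \<otimes> (a \<otimes> (g \<otimes> u)) \<otimes> h = h"
    using xx ab(4) by simp
  then show ?thesis
    using ab(1) g(1) uv(1) unfolding regular_elem_def
    by (intro conjI bexI[of _ "a \<otimes> (g \<otimes> u)"]) simp_all
qed

text \<open>The idempotent is \<open>g \<otimes> f\<close>. It is sought on the \<L> side because
  \<D> is \<L> followed by \<R>: a further \<L>-step in front is absorbed by transitivity.\<close>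

lemma regular_green_L_idempotent:
  assumes "regular_elem G f"
  obtains e where "e \<in> idempotents G" "(f, e) \<in> green_L G"
proof -
  obtain g where g: "g \<in> carrier G" "f \<otimes> g \<otimes> f = f" and f: "f \<in> carrier G"
    using assms by (auto simp: regular_elem_def)
  have "g \<otimes> f \<otimes> (g \<otimes> f) = g \<otimes> (f \<otimes> g \<otimes> f)"
    using f g(1) by (simp add: m_assoc)
  then have "g \<otimes> f \<in> idempotents G"
    using f g by (simp add: idempotents_def)
  moreover have "f = f \<otimes> (g \<otimes> f)"
    using f g by (simp add: m_assoc)
  then have "(f, g \<otimes> f) \<in> green_L G"
    using f g(1) unfolding green_L_iff by auto
  ultimately show thesis using that by blast
qed

lemma idempotent_green_L: "e \<in> idempotents G \<Longrightarrow> (h, e) \<in> green_L G \<Longrightarrow> h \<otimes> e = h"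
  by (auto simp: green_L_iff idempotents_def m_assoc)

lemma idempotent_green_R: "e \<in> idempotents G \<Longrightarrow> (h, e) \<in> green_R G \<Longrightarrow> e \<otimes> h = h"
  by (auto simp: green_R_iff idempotents_def simp flip: m_assoc)

text \<open>The product \<open>e \<otimes> f\<close> is \<open>e\<close>, as \<open>f\<close> is a
  right identity on its \<L>-class, and it is \<open>f\<close>, as \<open>e\<close> is a left
  identity on its \<R>-class. Distinct idempotents therefore yield distinct group
  \<H>-classes.\<close>

lemma green_H_idempotents_eq:
  assumes "e \<in> idempotents G" "f \<in> idempotents G" "(e, f) \<in> green_H G"
  shows "e = f"
proof -
  have "e \<otimes> f = e"
    using idempotent_green_L assms by (auto simp: green_H_def)
  moreover have "(f, e) \<in> green_R G"
    using assms(3) by (auto simp: green_H_def green_R_def)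
  then have "e \<otimes> f = f"
    using idempotent_green_R assms by blast
  ultimately show ?thesis by simp
qed

end

section \<open>Digraph homomorphisms and endomorphism monoids\<close>

definition digraph_hom :: "'a set \<Rightarrow> 'a rel \<Rightarrow> 'b set \<Rightarrow> 'b rel \<Rightarrow> ('a \<Rightarrow> 'b) \<Rightarrow> bool" where
  "digraph_hom V E W F f \<longleftrightarrow>
     f \<in> V \<rightarrow> W \<and> (\<forall>u\<in>V. \<forall>v\<in>V. (u, v) \<in> E \<longrightarrow> (f u, f v) \<in> F)"

lemma digraph_hom_comp:
  "digraph_hom V E W F f \<Longrightarrow> digraph_hom W F X H g \<Longrightarrow> digraph_hom V E X H (g \<circ> f)"
  by (auto simp: digraph_hom_def Pi_iff)

lemma digraph_iso_if_inverse_homs: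
  assumes f: "digraph_hom V E W F f" and g: "digraph_hom W F V E g"
    and gf: "\<And>v. v \<in> V \<Longrightarrow> g (f v) = v" and fg: "\<And>w. w \<in> W \<Longrightarrow> f (g w) = w"
  shows "digraph_iso V E W F f"
proof -
  have "bij_betw f V W"
    using f g gf fg by (intro bij_betwI[where g = g]) (auto simp: digraph_hom_def)
  moreover have "(u, v) \<in> E" if "u \<in> V" "v \<in> V" "(f u, f v) \<in> F" for u v
  proof -
    have "f u \<in> W" "f v \<in> W" using f that by (auto simp: digraph_hom_def)
    then have "(g (f u), g (f v)) \<in> E" using g that by (auto simp: digraph_hom_def)
    then show ?thesis using gf that by simp
  qed
  ultimately show ?thesis
    using f by (auto simp: digraph_iso_def digraph_hom_def)
qed

lemma digraph_iso_imp_hom: "digraph_iso V E W F f \<Longrightarrow> digraph_hom V E W F f"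
  by (auto simp: digraph_iso_def digraph_hom_def bij_betw_def)

lemma digraph_iso_inv_into:
  assumes "digraph_iso V E W F f"
  shows "digraph_iso W F V E (inv_into V f)"
proof -
  have b: "bij_betw f V W" using assms by (simp add: digraph_iso_def)
  have "(u, v) \<in> F \<longleftrightarrow> (inv_into V f u, inv_into V f v) \<in> E" if "u \<in> W" "v \<in> W" for u v
  proof -
    have "inv_into V f u \<in> V" "inv_into V f v \<in> V"
      using b that by (auto simp: bij_betw_def inv_into_into)
    moreover have "f (inv_into V f u) = u" "f (inv_into V f v) = v"
      using b that by (auto simp: bij_betw_inv_into_right)
    ultimately show ?thesis
      using assms unfolding digraph_iso_def by metis
  qed
  then show ?thesis
    using bij_betw_inv_into[OF b] by (auto simp: digraph_iso_def)
qed

lemma digraph_iso_comp: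
  assumes "digraph_iso V E W F f" "digraph_iso W F X H g"
  shows "digraph_iso V E X H (g \<circ> f)"
proof -
  have "f v \<in> W" if "v \<in> V" for v
    using assms(1) that by (auto simp: digraph_iso_def bij_betw_def)
  then show ?thesis
    using assms by (auto simp: digraph_iso_def intro: bij_betw_trans)
qed

lemma digraph_iso_cong:
  "(\<And>v. v \<in> V \<Longrightarrow> f v = g v) \<Longrightarrow> digraph_iso V E W F f \<longleftrightarrow> digraph_iso V E W F g"
  unfolding digraph_iso_def by (metis (no_types, lifting) bij_betw_cong)

text \<open>Conjugation by \<open>\<theta>\<close>, cut down to \<open>W\<close> because
  automorphisms are \<open>undefined\<close> elsewhere.\<close>

lemma Aut_digraph_iso:
  assumes iso: "digraph_iso V E W F \<theta>"
  shows "Aut_digraph V E \<cong> Aut_digraph W F"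
proof -
  define \<theta>' where "\<theta>' = inv_into V \<theta>"
  have iso': "digraph_iso W F V E \<theta>'"
    using digraph_iso_inv_into[OF iso] by (simp add: \<theta>'_def)
  have b: "bij_betw \<theta> V W" using iso by (simp add: digraph_iso_def)
  have in_W[simp]: "\<theta> v \<in> W" if "v \<in> V" for v using b that by (auto simp: bij_betw_def)
  have in_V[simp]: "\<theta>' w \<in> V" if "w \<in> W" for w
    using b that by (auto simp: \<theta>'_def bij_betw_def inv_into_into)
  have inv1[simp]: "\<theta> (\<theta>' w) = w" if "w \<in> W" for w
    using b that by (auto simp: \<theta>'_def bij_betw_inv_into_right)
  have inv2[simp]: "\<theta>' (\<theta> v) = v" if "v \<in> V" for v
    using b that by (auto simp: \<theta>'_def bij_betw_inv_into_left)
  let ?c = "\<lambda>\<alpha>. restrict (\<theta> \<circ> \<alpha> \<circ> \<theta>') W"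
  let ?d = "\<lambda>\<beta>. restrict (\<theta>' \<circ> \<beta> \<circ> \<theta>) V"
  have c: "?c \<alpha> \<in> carrier (Aut_digraph W F)" if "\<alpha> \<in> carrier (Aut_digraph V E)" for \<alpha>
  proof -
    have "digraph_iso W F W F (\<theta> \<circ> (\<alpha> \<circ> \<theta>'))"
      using that by (intro digraph_iso_comp[OF digraph_iso_comp[OF iso'] iso])
        (auto simp: Aut_digraph_def)
    then have "digraph_iso W F W F (?c \<alpha>)"
      by (subst digraph_iso_cong[where g = "\<theta> \<circ> (\<alpha> \<circ> \<theta>')"]) auto
    then show ?thesis by (simp add: Aut_digraph_def)
  qed
  have d: "?d \<beta> \<in> carrier (Aut_digraph V E)" if "\<beta> \<in> carrier (Aut_digraph W F)" for \<beta>
  proof -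
    have "digraph_iso V E V E (\<theta>' \<circ> (\<beta> \<circ> \<theta>))"
      using that by (intro digraph_iso_comp[OF digraph_iso_comp[OF iso] iso'])
        (auto simp: Aut_digraph_def)
    then have "digraph_iso V E V E (?d \<beta>)"
      by (subst digraph_iso_cong[where g = "\<theta>' \<circ> (\<beta> \<circ> \<theta>)"]) auto
    then show ?thesis by (simp add: Aut_digraph_def)
  qed
  have AV: "\<alpha> v \<in> V" if "\<alpha> \<in> carrier (Aut_digraph V E)" "v \<in> V" for \<alpha> v
    using that by (auto simp: Aut_digraph_def digraph_iso_def bij_betw_def)
  have AW: "\<alpha> v \<in> W" if "\<alpha> \<in> carrier (Aut_digraph W F)" "v \<in> W" for \<alpha> v
    using that by (auto simp: Aut_digraph_def digraph_iso_def bij_betw_def)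
  have "bij_betw ?c (carrier (Aut_digraph V E)) (carrier (Aut_digraph W F))"
  proof (intro bij_betwI[where g = ?d])
    show "?d (?c \<alpha>) = \<alpha>" if "\<alpha> \<in> carrier (Aut_digraph V E)" for \<alpha>
      using AV[OF that] that
      by (intro extensionalityI[where A = V]) (auto simp: Aut_digraph_def)
    show "?c (?d \<beta>) = \<beta>" if "\<beta> \<in> carrier (Aut_digraph W F)" for \<beta>
      using AW[OF that] that
      by (intro extensionalityI[where A = W]) (auto simp: Aut_digraph_def)
  qed (use c d in auto)
  moreover have "?c \<in> hom (Aut_digraph V E) (Aut_digraph W F)"
  proof (rule homI)
    fix \<alpha> \<beta> assume ab: "\<alpha> \<in> carrier (Aut_digraph V E)" "\<beta> \<in> carrier (Aut_digraph V E)"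
    show "?c (\<alpha> \<otimes>\<^bsub>Aut_digraph V E\<^esub> \<beta>) = ?c \<alpha> \<otimes>\<^bsub>Aut_digraph W F\<^esub> ?c \<beta>"
      using AV[OF ab(1)] AV[OF ab(2)]
      by (intro extensionalityI[where A = W]) (auto simp: Aut_digraph_def compose_def)
  qed (use c in auto)
  ultimately show ?thesis
    by (auto simp: is_iso_def iso_def)
qed

section \<open>Endomorphisms as extensional maps\<close>

lemma carrier_End_digraph:
  "f \<in> carrier (End_digraph V E) \<longleftrightarrow> f \<in> extensional V \<and> digraph_hom V E V E f"
  by (auto simp: End_digraph_def digraph_hom_def PiE_def)

lemma restrict_in_End: "digraph_hom V E V E f \<Longrightarrow> restrict f V \<in> carrier (End_digraph V E)"
  by (auto simp: carrier_End_digraph digraph_hom_def)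

lemma mult_End_digraph: "f \<otimes>\<^bsub>End_digraph V E\<^esub> g = compose V g f"
  by (simp add: End_digraph_def)

lemma mult_End_digraph_apply: "v \<in> V \<Longrightarrow> (f \<otimes>\<^bsub>End_digraph V E\<^esub> g) v = g (f v)"
  by (simp add: mult_End_digraph compose_def)

lemma End_digraph_in: "f \<in> carrier (End_digraph V E) \<Longrightarrow> v \<in> V \<Longrightarrow> f v \<in> V"
  by (auto simp: End_digraph_def)

lemma End_digraph_edge:
  "f \<in> carrier (End_digraph V E) \<Longrightarrow> u \<in> V \<Longrightarrow> v \<in> V \<Longrightarrow> (u, v) \<in> E \<Longrightarrow> (f u, f v) \<in> E"
  by (auto simp: End_digraph_def)

lemma End_digraph_eqI:
  "f \<in> carrier (End_digraph V E) \<Longrightarrow> g \<in> carrier (End_digraph V E) \<Longrightarrow>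
     (\<And>v. v \<in> V \<Longrightarrow> f v = g v) \<Longrightarrow> f = g"
  by (auto simp: carrier_End_digraph intro: extensionalityI)

lemma monoid_End_digraph: "monoid (End_digraph V E)"
proof (rule monoidI)
  fix f g assume "f \<in> carrier (End_digraph V E)" "g \<in> carrier (End_digraph V E)"
  then show "f \<otimes>\<^bsub>End_digraph V E\<^esub> g \<in> carrier (End_digraph V E)"
    by (auto simp: End_digraph_def compose_def PiE_def Pi_iff)
next
  fix f g h
  assume "f \<in> carrier (End_digraph V E)" "g \<in> carrier (End_digraph V E)"
    "h \<in> carrier (End_digraph V E)"
  then show "f \<otimes>\<^bsub>End_digraph V E\<^esub> g \<otimes>\<^bsub>End_digraph V E\<^esub> h
      = f \<otimes>\<^bsub>End_digraph V E\<^esub> (g \<otimes>\<^bsub>End_digraph V E\<^esub> h)"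
    by (auto simp: End_digraph_def compose_def fun_eq_iff PiE_def Pi_iff)
qed (auto simp: End_digraph_def compose_def PiE_def extensional_def fun_eq_iff)

text \<open>An endomorphism is coded by its graph, a set of pairs of naturals. The bound serves both
  counts, since \<D>-classes and \<H>-classes are indexed by elements of the monoid.\<close>

lemma End_digraph_lepoll:
  assumes "countable V"
  shows "carrier (End_digraph V E) \<lesssim> (UNIV :: nat set set)"
proof -
  define code where
    "code f = (\<lambda>v. prod_encode (to_nat_on V v, to_nat_on V (f v))) ` V" for f :: "'a \<Rightarrow> 'a"
  have inj: "x = y" if "to_nat_on V x = to_nat_on V y" "x \<in> V" "y \<in> V" for x y
    using that assms by (metis to_nat_on_inj)
  have "inj_on code (carrier (End_digraph V E))"
  proof (rule inj_onI)
    fix f g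
    assume f: "f \<in> carrier (End_digraph V E)" and g: "g \<in> carrier (End_digraph V E)"
      and eq: "code f = code g"
    show "f = g"
    proof (rule End_digraph_eqI[OF f g])
      fix v assume v: "v \<in> V"
      then have "prod_encode (to_nat_on V v, to_nat_on V (f v)) \<in> code g"
        unfolding eq[symmetric] by (auto simp: code_def)
      then show "f v = g v"
        using v inj End_digraph_in[OF f] End_digraph_in[OF g] by (auto simp: code_def) metis
    qed
  qed
  then show ?thesis by (auto simp: lepoll_def)
qed

section \<open>Idempotents and their images\<close>

abbreviation image_edges :: "'a set \<Rightarrow> 'a rel \<Rightarrow> ('a \<Rightarrow> 'a) \<Rightarrow> 'a rel" where
  "image_edges V E e \<equiv> Restr E (e ` V)"

lemma idempotents_End_iff:
  "e \<in> idempotents (End_digraph V E) \<longleftrightarrow>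
     e \<in> carrier (End_digraph V E) \<and> (\<forall>x\<in>e ` V. e x = x)"
proof -
  interpret monoid "End_digraph V E" by (rule monoid_End_digraph)
  have "e \<otimes>\<^bsub>End_digraph V E\<^esub> e = e \<longleftrightarrow> (\<forall>v\<in>V. e (e v) = e v)"
    if "e \<in> carrier (End_digraph V E)"
  proof
    assume "\<forall>v\<in>V. e (e v) = e v"
    then show "e \<otimes>\<^bsub>End_digraph V E\<^esub> e = e"
      using that by (intro End_digraph_eqI[where V = V and E = E])
        (auto simp: mult_End_digraph_apply)
  qed (metis mult_End_digraph_apply)
  then show ?thesis
    by (auto simp: idempotents_def)
qed

text \<open>With maps on the right, \<L>-related maps have the same image, so \<open>e\<close> and
  \<open>x\<close> share theirs. The multipliers \<open>w\<close> and \<open>y\<close> that witness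
  \<open>x\<close> \<R> \<open>f\<close> turn values of \<open>x\<close> into values of
  \<open>f\<close> and back; on the two images they are mutually inverse homomorphisms.\<close>

lemma green_D_imp_image_iso:
  assumes e: "e \<in> idempotents (End_digraph V E)" and f: "f \<in> idempotents (End_digraph V E)"
    and D: "(e, f) \<in> green_D (End_digraph V E)"
  shows "\<exists>\<theta>. digraph_iso (e ` V) (image_edges V E e) (f ` V) (image_edges V E f) \<theta>"
proof -
  let ?M = "End_digraph V E"
  interpret monoid ?M by (rule monoid_End_digraph)
  obtain x where x: "(e, x) \<in> green_L ?M" "(x, f) \<in> green_R ?M"
    using D by (auto simp: green_D_def)
  obtain u v where uv: "u \<in> carrier ?M" "e = u \<otimes>\<^bsub>?M\<^esub> x" "v \<in> carrier ?M" "x = v \<otimes>\<^bsub>?M\<^esub> e"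
      and ex: "e \<in> carrier ?M" "x \<in> carrier ?M"
    using x(1) by (auto simp: green_L_iff)
  obtain y w where yw: "y \<in> carrier ?M" "x = f \<otimes>\<^bsub>?M\<^esub> y" "w \<in> carrier ?M" "f = x \<otimes>\<^bsub>?M\<^esub> w"
      and fc: "f \<in> carrier ?M"
    using x(2) by (auto simp: green_R_iff)
  have eq: "e p = x (u p)" "x p = e (v p)" "x p = y (f p)" "f p = w (x p)" if "p \<in> V" for p
  proof -
    note m = mult_End_digraph_apply[OF that, of E]
    show "e p = x (u p)" "x p = e (v p)" "x p = y (f p)" "f p = w (x p)"
      using m[of u x] m[of v e] m[of f y] m[of x w] by (simp_all flip: uv(2,4) yw(2,4))
  qed
  have V: "u p \<in> V" "v p \<in> V" "y p \<in> V" "w p \<in> V" "e p \<in> V" "f p \<in> V" if "p \<in> V" for p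
    using that uv(1,3) yw(1,3) ex(1) fc by (auto intro: End_digraph_in)
  have e_fix: "e p = p" if "p \<in> e ` V" for p using e that by (auto simp: idempotents_End_iff)
  have f_fix: "f p = p" if "p \<in> f ` V" for p using f that by (auto simp: idempotents_End_iff)
  have im: "p \<in> V" if "p \<in> e ` V \<or> p \<in> f ` V" for p using that V by auto
  have w: "w p = f (u p)" if "p \<in> e ` V" for p
    using eq(1)[OF im] eq(4)[OF V(1)[OF im]] e_fix that by metis
  have y: "y q = e (v q)" if "q \<in> f ` V" for q
    using eq(2,3)[OF im] f_fix that by metis
  have "digraph_hom (e ` V) (image_edges V E e) (f ` V) (image_edges V E f) w"
    unfolding digraph_hom_def
  proof (intro conjI ballI impI Pi_I)
    show w_im: "w p \<in> f ` V" if "p \<in> e ` V" for p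
      using w[OF that] V(1)[OF im] that by blast
    show "(w p, w q) \<in> image_edges V E f"
      if "p \<in> e ` V" "q \<in> e ` V" "(p, q) \<in> image_edges V E e" for p q
      using End_digraph_edge[OF yw(3) im im, of p q] w_im that by blast
  qed
  moreover have "digraph_hom (f ` V) (image_edges V E f) (e ` V) (image_edges V E e) y"
    unfolding digraph_hom_def
  proof (intro conjI ballI impI Pi_I)
    show y_im: "y p \<in> e ` V" if "p \<in> f ` V" for p
      using y[OF that] V(2)[OF im] that by blast
    show "(y p, y q) \<in> image_edges V E e"
      if "p \<in> f ` V" "q \<in> f ` V" "(p, q) \<in> image_edges V E f" for p q
      using End_digraph_edge[OF yw(1) im im, of p q] y_im that by blast
  qed
  moreover have "y (w p) = p" if "p \<in> e ` V" for p
    using w[OF that] eq(1)[OF im] eq(3)[OF V(1)[OF im]] e_fix that by metis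
  moreover have "w (y q) = q" if "q \<in> f ` V" for q
    using eq(3,4)[OF im] f_fix that by metis
  ultimately have "digraph_iso (e ` V) (image_edges V E e) (f ` V) (image_edges V E f) w"
    by (rule digraph_iso_if_inverse_homs)
  then show ?thesis by (rule exI[of _ w])
qed

text \<open>The intermediate element \<open>x\<close> needs the image of \<open>e\<close> and the
  kernel of \<open>f\<close>, so it is \<open>f\<close> followed by the inverse of
  \<open>\<theta>\<close>. The single map \<open>u\<close>, which is \<open>e\<close> followed by
  \<open>\<theta>\<close>, leads from \<open>x\<close> back to both:
  \<open>e = u \<otimes> x\<close> and \<open>f = x \<otimes> u\<close>.\<close>

lemma image_iso_imp_green_D:
  assumes e: "e \<in> idempotents (End_digraph V E)" and f: "f \<in> idempotents (End_digraph V E)"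
    and iso: "digraph_iso (e ` V) (image_edges V E e) (f ` V) (image_edges V E f) \<theta>"
  shows "(e, f) \<in> green_D (End_digraph V E)"
proof -
  let ?M = "End_digraph V E"
  interpret monoid ?M by (rule monoid_End_digraph)
  define \<theta>' where "\<theta>' = inv_into (e ` V) \<theta>"
  have b: "bij_betw \<theta> (e ` V) (f ` V)" using iso by (simp add: digraph_iso_def)
  have ec: "e \<in> carrier ?M" and fc: "f \<in> carrier ?M"
    using e f by (auto simp: idempotents_End_iff)
  have e_fix: "e p = p" if "p \<in> e ` V" for p using e that by (auto simp: idempotents_End_iff)
  have f_fix: "f p = p" if "p \<in> f ` V" for p using f that by (auto simp: idempotents_End_iff)
  \<comment> \<open>A homomorphism between two images becomes an endomorphism once \<open>g\<close>
    is applied before it and its values are read in \<open>V\<close>.\<close>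
  have inc: "digraph_hom V E V E h"
    if "g \<in> carrier ?M" "k \<in> carrier ?M" "h = \<eta> \<circ> g"
      "digraph_hom (g ` V) (image_edges V E g) (k ` V) (image_edges V E k) \<eta>" for g h k \<eta>
  proof -
    have "\<eta> (g p) \<in> k ` V" if "p \<in> V" for p
      using \<open>digraph_hom _ _ _ _ \<eta>\<close> that by (auto simp: digraph_hom_def)
    moreover have "(\<eta> (g p), \<eta> (g q)) \<in> E" if "p \<in> V" "q \<in> V" "(p, q) \<in> E" for p q
      using \<open>digraph_hom _ _ _ _ \<eta>\<close> End_digraph_edge[OF \<open>g \<in> carrier ?M\<close> that] that
      by (auto simp: digraph_hom_def)
    moreover have "k ` V \<subseteq> V" using End_digraph_in[OF that(2)] by blast
    ultimately show ?thesis
      unfolding \<open>h = \<eta> \<circ> g\<close> digraph_hom_def by auto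
  qed
  define u where "u = restrict (\<theta> \<circ> e) V"
  define x where "x = restrict (\<theta>' \<circ> f) V"
  have hom': "digraph_hom (f ` V) (image_edges V E f) (e ` V) (image_edges V E e) \<theta>'"
    unfolding \<theta>'_def by (intro digraph_iso_imp_hom digraph_iso_inv_into iso)
  have u: "u \<in> carrier ?M"
    unfolding u_def using inc[OF ec fc refl digraph_iso_imp_hom[OF iso]]
    by (intro restrict_in_End) auto
  have x: "x \<in> carrier ?M"
    unfolding x_def using inc[OF fc ec refl hom'] by (intro restrict_in_End) auto
  have u_im: "u p \<in> f ` V" if "p \<in> V" for p using b that by (auto simp: u_def bij_betw_def)
  have x_im: "x p \<in> e ` V" if "p \<in> V" for p
    using b that by (auto simp: x_def \<theta>'_def bij_betw_def intro: inv_into_into)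
  have inv1: "\<theta> (\<theta>' q) = q" if "q \<in> f ` V" for q
    using b that by (simp add: \<theta>'_def bij_betw_inv_into_right)
  have inv2: "\<theta>' (\<theta> q) = q" if "q \<in> e ` V" for q
    using b that by (simp add: \<theta>'_def bij_betw_inv_into_left)
  have mult: "(a \<otimes>\<^bsub>?M\<^esub> b) p = b (a p)" if "p \<in> V" for a b p
    using that by (rule mult_End_digraph_apply)
  have V: "u p \<in> V" "x p \<in> V" "f p \<in> V" if "p \<in> V" for p
    using that u x fc by (auto intro: End_digraph_in)
  have "e = u \<otimes>\<^bsub>?M\<^esub> x"
  proof (rule End_digraph_eqI[where V = V and E = E])
    fix p assume p: "p \<in> V"
    have "x (u p) = \<theta>' (f (u p))" using V(1)[OF p] by (simp add: x_def)
    also have "\<dots> = \<theta>' (u p)" using f_fix[OF u_im[OF p]] by simp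
    also have "\<dots> = e p" using inv2[OF imageI[OF p]] p by (simp add: u_def)
    finally show "e p = (u \<otimes>\<^bsub>?M\<^esub> x) p" using mult[OF p] by simp
  qed (use x u ec in auto)
  moreover have "x = x \<otimes>\<^bsub>?M\<^esub> e"
  proof (rule End_digraph_eqI[where V = V and E = E])
    fix p assume p: "p \<in> V"
    show "x p = (x \<otimes>\<^bsub>?M\<^esub> e) p" using mult[OF p] e_fix[OF x_im[OF p]] by simp
  qed (use x ec in auto)
  ultimately have L: "(e, x) \<in> green_L ?M"
    using u x ec unfolding green_L_iff by blast
  have "f = x \<otimes>\<^bsub>?M\<^esub> u"
  proof (rule End_digraph_eqI[where V = V and E = E])
    fix p assume p: "p \<in> V"
    have "u (x p) = \<theta> (e (x p))" using V(2)[OF p] by (simp add: u_def)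
    also have "\<dots> = \<theta> (x p)" using e_fix[OF x_im[OF p]] by simp
    also have "\<dots> = f p" using inv1[OF imageI[OF p]] p by (simp add: x_def)
    finally show "f p = (x \<otimes>\<^bsub>?M\<^esub> u) p" using mult[OF p] by simp
  qed (use x u fc in auto)
  moreover have "x = f \<otimes>\<^bsub>?M\<^esub> x"
  proof (rule End_digraph_eqI[where V = V and E = E])
    fix p assume p: "p \<in> V"
    then show "x p = (f \<otimes>\<^bsub>?M\<^esub> x) p"
      using mult[OF p] V(3)[OF p] f_fix[OF imageI[OF p]] by (simp add: x_def)
  qed (use x fc in auto)
  ultimately have "(x, f) \<in> green_R ?M"
    using u x fc unfolding green_R_iff by blast
  with L show ?thesis by (auto simp: green_D_def)
qed

text \<open>The isomorphism is restriction to the image. An element \<open>h\<close> of the class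
  satisfies \<open>e \<otimes> h = h = h \<otimes> e\<close>, so it maps the image into itself and
  is determined there. From \<open>e = b \<otimes> h\<close> comes surjectivity on the image, from
  \<open>e = h \<otimes> d\<close> a homomorphic left inverse. Conversely, an automorphism of the
  image lifts by applying \<open>e\<close> first.\<close>

lemma H_group_iso_Aut_image:
  assumes e: "e \<in> idempotents (End_digraph V E)"
  shows "H_group (End_digraph V E) e \<cong> Aut_digraph (e ` V) (image_edges V E e)"
proof -
  let ?M = "End_digraph V E" and ?I = "e ` V"
  let ?H = "green_H ?M `` {e}" and ?A = "Aut_digraph ?I (image_edges V E e)"
  interpret monoid ?M by (rule monoid_End_digraph)
  have ec: "e \<in> carrier ?M" using e by (simp add: idempotents_End_iff)
  have e_fix: "e p = p" if "p \<in> ?I" for p using e that by (auto simp: idempotents_End_iff)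
  have im: "p \<in> V" if "p \<in> ?I" for p using that End_digraph_in[OF ec] by auto
  have Hc: "h \<in> carrier ?M" and H_left: "\<And>p. p \<in> V \<Longrightarrow> h (e p) = h p"
    and H_right: "\<And>p. p \<in> V \<Longrightarrow> e (h p) = h p"
    and H_aut: "restrict h ?I \<in> carrier ?A" if h: "h \<in> ?H" for h
  proof -
    have L: "(e, h) \<in> green_L ?M" "(h, e) \<in> green_L ?M"
      and R: "(e, h) \<in> green_R ?M" "(h, e) \<in> green_R ?M"
      using h by (auto simp: green_H_def green_L_def green_R_def)
    show hc: "h \<in> carrier ?M" using L by (simp add: green_L_iff)
    show left: "h (e p) = h p" if "p \<in> V" for p
      using idempotent_green_R[OF e R(2)] mult_End_digraph_apply[OF that] by metis
    show right: "e (h p) = h p" if "p \<in> V" for p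
      using idempotent_green_L[OF e L(2)] mult_End_digraph_apply[OF that] by metis
    obtain b where b: "b \<in> carrier ?M" "e = b \<otimes>\<^bsub>?M\<^esub> h" using L by (auto simp: green_L_iff)
    obtain d where d: "d \<in> carrier ?M" "e = h \<otimes>\<^bsub>?M\<^esub> d" using R by (auto simp: green_R_iff)
    have dh: "d (h p) = p" if "p \<in> ?I" for p
      using d(2) mult_End_digraph_apply[OF im[OF that], of E h d] e_fix[OF that] by simp
    have hI: "h p \<in> ?I" if "p \<in> V" for p
      using right[OF that] End_digraph_in[OF hc that] by (metis imageI)
    have "bij_betw h ?I ?I"
      unfolding bij_betw_def
    proof
      show "inj_on h ?I" using dh by (metis inj_onI)
      show "h ` ?I = ?I"
      proof
        show "h ` ?I \<subseteq> ?I" using hI im by blast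
        show "?I \<subseteq> h ` ?I"
        proof
          fix p assume p: "p \<in> ?I"
          have "p = h (b p)"
            using b(2) mult_End_digraph_apply[OF im[OF p], of E b h] e_fix[OF p] by simp
          also have "\<dots> = h (e (b p))"
            using left[OF End_digraph_in[OF b(1) im[OF p]]] by simp
          finally show "p \<in> h ` ?I" using End_digraph_in[OF b(1) im[OF p]] by blast
        qed
      qed
    qed
    moreover have "(p, q) \<in> image_edges V E e \<longleftrightarrow> (h p, h q) \<in> image_edges V E e"
      if "p \<in> ?I" "q \<in> ?I" for p q
      using that im[of p] im[of q] dh[of p] dh[of q] hI[of p] hI[of q] End_digraph_in[OF hc, of p]
        End_digraph_in[OF hc, of q] End_digraph_edge[OF hc, of p q]
        End_digraph_edge[OF d(1), of "h p" "h q"] by auto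
    ultimately have "digraph_iso ?I (image_edges V E e) ?I (image_edges V E e) h"
      by (simp add: digraph_iso_def)
    then have "digraph_iso ?I (image_edges V E e) ?I (image_edges V E e) (restrict h ?I)"
      by (subst digraph_iso_cong[where g = h]) auto
    then show "restrict h ?I \<in> carrier ?A" by (simp add: Aut_digraph_def)
  qed
  have lift: "restrict (\<alpha> \<circ> e) V \<in> ?H" if \<alpha>: "\<alpha> \<in> carrier ?A" for \<alpha>
  proof -
    have iso: "digraph_iso ?I (image_edges V E e) ?I (image_edges V E e) \<alpha>"
      using \<alpha> by (simp add: Aut_digraph_def)
    define \<alpha>' where "\<alpha>' = inv_into ?I \<alpha>"
    have iso': "digraph_iso ?I (image_edges V E e) ?I (image_edges V E e) \<alpha>'"
      unfolding \<alpha>'_def by (rule digraph_iso_inv_into[OF iso])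
    have b: "bij_betw \<alpha> ?I ?I" using iso by (simp add: digraph_iso_def)
    have b': "bij_betw \<alpha>' ?I ?I" using iso' by (simp add: digraph_iso_def)
    have End: "restrict (\<beta> \<circ> e) V \<in> carrier ?M"
      if "digraph_iso ?I (image_edges V E e) ?I (image_edges V E e) \<beta>" for \<beta>
    proof (rule restrict_in_End)
      show "digraph_hom V E V E (\<beta> \<circ> e)"
        using digraph_iso_imp_hom[OF that] im End_digraph_edge[OF ec]
        by (fastforce simp: digraph_hom_def)
    qed
    have inv: "\<alpha> (\<alpha>' p) = p" "\<alpha>' (\<alpha> p) = p" "\<alpha> p \<in> ?I" "\<alpha>' p \<in> ?I" if "p \<in> ?I" for p
      using b b' that
      by (auto simp: \<alpha>'_def bij_betw_inv_into_right bij_betw_inv_into_left bij_betw_apply)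
    let ?h = "restrict (\<alpha> \<circ> e) V" and ?k = "restrict (\<alpha>' \<circ> e) V"
    note c = End[OF iso] End[OF iso']
    have e_inv: "e p \<in> V" "e (e p) = e p" "\<alpha> (e p) \<in> V" "\<alpha>' (e p) \<in> V" "e (\<alpha> (e p)) = \<alpha> (e p)"
      "e (\<alpha>' (e p)) = \<alpha>' (e p)" "\<alpha> (\<alpha>' (e p)) = e p" "\<alpha>' (\<alpha> (e p)) = e p" if "p \<in> V" for p
      using inv[of "e p"] that im e_fix by blast+
    note [simp] = mult_End_digraph_apply e_inv
    have "e = ?k \<otimes>\<^bsub>?M\<^esub> ?h"
      by (rule End_digraph_eqI[where V = V and E = E]) (use c ec in auto)
    moreover have "e = ?h \<otimes>\<^bsub>?M\<^esub> ?k"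
      by (rule End_digraph_eqI[where V = V and E = E]) (use c ec in auto)
    moreover have "?h = ?h \<otimes>\<^bsub>?M\<^esub> e"
      by (rule End_digraph_eqI[where V = V and E = E]) (use c ec in auto)
    moreover have "?h = e \<otimes>\<^bsub>?M\<^esub> ?h"
      by (rule End_digraph_eqI[where V = V and E = E]) (use c ec in auto)
    ultimately have "(e, ?h) \<in> green_L ?M" "(e, ?h) \<in> green_R ?M"
      unfolding green_L_iff green_R_iff using c ec by blast+
    then show ?thesis
      by (simp add: green_H_def)
  qed
  have "bij_betw (\<lambda>h. restrict h ?I) ?H (carrier ?A)"
  proof (intro bij_betwI[where g = "\<lambda>\<alpha>. restrict (\<alpha> \<circ> e) V"])
    show "(\<lambda>h. restrict h ?I) \<in> ?H \<rightarrow> carrier ?A" using H_aut by blast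
    show "(\<lambda>\<alpha>. restrict (\<alpha> \<circ> e) V) \<in> carrier ?A \<rightarrow> ?H" using lift by blast
    show "restrict (restrict h ?I \<circ> e) V = h" if "h \<in> ?H" for h
      using Hc[OF that] H_left[OF that]
      by (intro extensionalityI[where A = V]) (auto simp: carrier_End_digraph)
    show "restrict (restrict (\<alpha> \<circ> e) V) ?I = \<alpha>" if "\<alpha> \<in> carrier ?A" for \<alpha>
    proof (rule extensionalityI[where A = ?I])
      show "restrict (restrict (\<alpha> \<circ> e) V) ?I p = \<alpha> p" if "p \<in> ?I" for p
        using that im[OF that] e_fix[OF that] by simp
    qed (use that in \<open>auto simp: Aut_digraph_def\<close>)
  qed
  moreover have "(\<lambda>h. restrict h ?I) \<in> hom (H_group ?M e) ?A"
  proof (rule homI)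
    fix g h assume gh: "g \<in> carrier (H_group ?M e)" "h \<in> carrier (H_group ?M e)"
    then have gh': "g \<in> ?H" "h \<in> ?H" by (auto simp: H_group_def)
    have "g p \<in> ?I" if "p \<in> ?I" for p
      using H_right[OF gh'(1)] End_digraph_in[OF Hc[OF gh'(1)]] im[OF that] by (metis imageI)
    then show "restrict (g \<otimes>\<^bsub>H_group ?M e\<^esub> h) ?I = restrict g ?I \<otimes>\<^bsub>?A\<^esub> restrict h ?I"
      using im by (intro ext) (simp add: H_group_def Aut_digraph_def mult_End_digraph compose_def)
  qed (use H_aut in \<open>auto simp: H_group_def\<close>)
  ultimately show ?thesis
    by (auto simp: is_iso_def iso_def H_group_def)
qed

section \<open>Retracts of the universal digraph\<close>

text \<open>Existential closedness from age and homogeneity. A copy of \<open>S\<close> on the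
  numbers below \<open>n\<close>, with \<open>n\<close> itself as the desired new vertex, embeds
  somewhere in \<open>V\<close>; homogeneity supplies an automorphism \<open>g\<close> that moves
  the embedded copy of \<open>S\<close> onto \<open>S\<close>, and \<open>g\<close> carries the
  extra vertex to the right place.\<close>

lemma universal_digraph_extension:
  assumes U: "universal_digraph V E" and S: "finite S" "S \<subseteq> V" and IO: "I \<subseteq> S" "O' \<subseteq> S"
  obtains v where "v \<in> V" "v \<notin> S"
    "\<And>s. s \<in> S \<Longrightarrow> (s, v) \<in> E \<longleftrightarrow> s \<in> I" "\<And>s. s \<in> S \<Longrightarrow> (v, s) \<in> E \<longleftrightarrow> s \<in> O'"
proof -
  define n where "n = card S"
  obtain \<sigma> where \<sigma>: "bij_betw \<sigma> {..<n} S"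
    using ex_bij_betw_nat_finite[OF S(1)] by (auto simp: n_def atLeast0LessThan)
  have \<sigma>S: "\<sigma> i \<in> S" if "i < n" for i using \<sigma> that by (auto simp: bij_betw_def)
  define F where "F = {(i, j). i < n \<and> j < n \<and> (\<sigma> i, \<sigma> j) \<in> E} \<union>
    {(i, n) | i. i < n \<and> \<sigma> i \<in> I} \<union> {(n, i) | i. i < n \<and> \<sigma> i \<in> O'}"
  have irr: "(x, x) \<notin> E" for x
    using U by (auto simp: universal_digraph_def digraph_def irrefl_def)
  have "digraph {..n} F"
    using irr by (auto simp: digraph_def F_def irrefl_def)
  then obtain f where f: "digraph_embedding {..n} F V E f"
    using U unfolding universal_digraph_def by (meson finite_atMost)
  have fV: "f i \<in> V" if "i \<le> n" for i using f that by (auto simp: digraph_embedding_def)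
  have finj: "inj_on f {..n}" using f by (auto simp: digraph_embedding_def)
  have fF: "(i, j) \<in> F \<longleftrightarrow> (f i, f j) \<in> E" if "i \<le> n" "j \<le> n" for i j
    using f that by (auto simp: digraph_embedding_def)
  define \<tau> where "\<tau> = \<sigma> \<circ> inv_into {..<n} f"
  have finj': "inj_on f {..<n}" using finj by (rule inj_on_subset) auto
  have \<tau>f: "\<tau> (f i) = \<sigma> i" if "i < n" for i using finj' that by (simp add: \<tau>_def)
  have "bij_betw \<tau> (f ` {..<n}) S"
    unfolding \<tau>_def
    using bij_betw_trans[OF bij_betw_inv_into[OF inj_on_imp_bij_betw[OF finj']] \<sigma>] .
  moreover have "(f i, f j) \<in> E \<longleftrightarrow> (\<sigma> i, \<sigma> j) \<in> E" if "i < n" "j < n" for i j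
    using fF[of i j] that by (auto simp: F_def)
  ultimately have "digraph_iso (f ` {..<n}) (Restr E (f ` {..<n})) S (Restr E S) \<tau>"
    using \<tau>f \<sigma>S by (auto simp: digraph_iso_def)
  moreover have "f ` {..<n} \<subseteq> V" using fV by auto
  ultimately obtain g where g: "g \<in> carrier (Aut_digraph V E)" "\<forall>x\<in>f ` {..<n}. g x = \<tau> x"
    using U S(2) unfolding universal_digraph_def by (metis finite_imageI finite_lessThan)
  have gb: "bij_betw g V V" using g(1) by (simp add: Aut_digraph_def digraph_iso_def)
  have gE: "(u, v) \<in> E \<longleftrightarrow> (g u, g v) \<in> E" if "u \<in> V" "v \<in> V" for u v
    using g(1) that by (auto simp: Aut_digraph_def digraph_iso_def)
  have gf: "g (f i) = \<sigma> i" if "i < n" for i using g(2) \<tau>f that by simp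
  have S_eq: "\<exists>i<n. s = \<sigma> i" if "s \<in> S" for s using \<sigma> that by (auto simp: bij_betw_def)
  show thesis
  proof
    show v: "g (f n) \<in> V" using gb fV[of n] by (auto simp: bij_betw_def)
    show "g (f n) \<notin> S"
    proof
      assume "g (f n) \<in> S"
      then obtain i where i: "i < n" "g (f n) = g (f i)" using S_eq gf by metis
      then have "f n = f i" using gb fV by (auto simp: bij_betw_def inj_on_def)
      then show False using inj_onD[OF finj, of n i] i(1) by simp
    qed
    fix s assume "s \<in> S"
    then obtain i where i: "i < n" "s = g (f i)" "s = \<sigma> i" using S_eq gf by metis
    have "(s, g (f n)) \<in> E \<longleftrightarrow> (i, n) \<in> F" "(g (f n), s) \<in> E \<longleftrightarrow> (n, i) \<in> F"
      using gE[of "f i" "f n"] gE[of "f n" "f i"] fV i fF by auto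
    then show "(s, g (f n)) \<in> E \<longleftrightarrow> s \<in> I" "(g (f n), s) \<in> E \<longleftrightarrow> s \<in> O'"
      using i by (auto simp: F_def)
  qed
qed

text \<open>The algebraically closed digraphs: a two-way common neighbour satisfies every demand for
  edges to and from \<open>S\<close> at once. The empty \<open>S\<close> makes \<open>V\<close>
  nonempty.\<close>

definition alg_closed :: "'a set \<Rightarrow> 'a rel \<Rightarrow> bool" where
  "alg_closed V E \<longleftrightarrow>
     (\<forall>S. finite S \<and> S \<subseteq> V \<longrightarrow> (\<exists>v\<in>V. \<forall>s\<in>S. (s, v) \<in> E \<and> (v, s) \<in> E))"

lemma universal_digraph_alg_closed:
  assumes "universal_digraph V E"
  shows "alg_closed V E"
  unfolding alg_closed_def
proof (intro allI impI)
  fix S assume S: "finite S \<and> S \<subseteq> V"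
  then have S': "finite S" "S \<subseteq> V" by auto
  obtain v where "v \<in> V" "\<And>s. s \<in> S \<Longrightarrow> (s, v) \<in> E \<longleftrightarrow> s \<in> S" "\<And>s. s \<in> S \<Longrightarrow> (v, s) \<in> E \<longleftrightarrow> s \<in> S"
    by (rule universal_digraph_extension[OF assms S' subset_refl subset_refl]) (rule that)
  then show "\<exists>v\<in>V. \<forall>s\<in>S. (s, v) \<in> E \<and> (v, s) \<in> E" by blast
qed

text \<open>A common neighbour of all of \<open>V\<close> would carry a loop.\<close>

lemma alg_closed_infinite:
  assumes "digraph V E" "alg_closed V E"
  shows "infinite V"
proof
  assume "finite V"
  then obtain v where "v \<in> V" "(v, v) \<in> E"
    using assms(2) unfolding alg_closed_def by blast
  then show False using assms(1) by (auto simp: digraph_def irrefl_def)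
qed

text \<open>\<open>e\<close> fixes \<open>S\<close> pointwise and preserves edges, so it moves a
  common neighbour of \<open>S\<close> to one inside the image.\<close>

lemma alg_closed_image:
  assumes e: "e \<in> idempotents (End_digraph V E)" and ac: "alg_closed V E"
  shows "alg_closed (e ` V) (image_edges V E e)"
  unfolding alg_closed_def
proof (intro allI impI)
  fix S assume S: "finite S \<and> S \<subseteq> e ` V"
  have ec: "e \<in> carrier (End_digraph V E)" using e by (simp add: idempotents_End_iff)
  then have SV: "S \<subseteq> V" using S End_digraph_in[OF ec] by auto
  then obtain v where v: "v \<in> V" "\<forall>s\<in>S. (s, v) \<in> E \<and> (v, s) \<in> E"
    using ac S unfolding alg_closed_def by blast
  have "(s, e v) \<in> E \<and> (e v, s) \<in> E" if "s \<in> S" for s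
  proof -
    have "e s = s" using e S that by (auto simp: idempotents_End_iff)
    then show ?thesis
      using End_digraph_edge[OF ec, of s v] End_digraph_edge[OF ec, of v s] that SV v by auto
  qed
  then show "\<exists>v\<in>e ` V. \<forall>s\<in>S. (s, v) \<in> image_edges V E e \<and> (v, s) \<in> image_edges V E e"
    using S v(1) by (intro bexI[of _ "e v"]) auto
qed

text \<open>Both partial maps are grown simultaneously. A new vertex of the retract gets an image adjacent
  only to the images already present, so that the retraction extends to it; a new vertex of the
  universal digraph is retracted to a two-way common neighbour of everything used so far.\<close>

lemma alg_closed_retract:
  fixes V :: "'a set" and W :: "'c set"
  assumes U: "universal_digraph V E" and W: "countable W" "digraph W F" "alg_closed W F"
  obtains \<phi> \<psi> where "digraph_hom W F V E \<phi>" "digraph_hom V E W F \<psi>"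
    "\<And>w. w \<in> W \<Longrightarrow> \<psi> (\<phi> w) = w"
proof -
  \<comment> \<open>\<open>p\<close> approximates the section and \<open>q\<close> the retraction.
    Since \<open>q\<close> inverts \<open>p\<close>, all values of \<open>p\<close> lie in
    \<open>dom q\<close>, and this one finite set contains every vertex of \<open>V\<close> used so
    far.\<close>
  define good :: "('c \<rightharpoonup> 'a) \<times> ('a \<rightharpoonup> 'c) \<Rightarrow> bool" where
    "good = (\<lambda>(p, q). finite (dom q) \<and> dom q \<subseteq> V \<and> ran q \<subseteq> W \<and>
       (\<forall>w v. p w = Some v \<longrightarrow> q v = Some w) \<and>
       (\<forall>w v w' v'. p w = Some v \<longrightarrow> p w' = Some v' \<longrightarrow> (w, w') \<in> F \<longrightarrow> (v, v') \<in> E) \<and>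
       (\<forall>w v w' v'. q v = Some w \<longrightarrow> q v' = Some w' \<longrightarrow> (v, v') \<in> E \<longrightarrow> (w, w') \<in> F))"
  define le where
    "le = (\<lambda>(p :: 'c \<rightharpoonup> 'a, q :: 'a \<rightharpoonup> 'c) (p' :: 'c \<rightharpoonup> 'a, q' :: 'a \<rightharpoonup> 'c). p \<subseteq>\<^sub>m p' \<and> q \<subseteq>\<^sub>m q')"
  have irrE: "(x, x) \<notin> E" for x
    using U by (auto simp: universal_digraph_def digraph_def irrefl_def)
  have irrF: "(x, x) \<notin> F" for x
    using W by (auto simp: digraph_def irrefl_def)
  have extW: "\<exists>t. good t \<and> le s t \<and> w \<in> dom (fst t)" if s: "good s" and w: "w \<in> W" for s w
  proof (cases "w \<in> dom (fst s)")
    case True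
    then show ?thesis using s by (intro exI[of _ s]) (auto simp: le_def map_le_def)
  next
    case False
    obtain p q where pq: "s = (p, q)" by fastforce
    have G: "finite (dom q)" "dom q \<subseteq> V" "ran q \<subseteq> W" and pqinv: "\<And>w v. p w = Some v \<Longrightarrow> q v = Some w"
      and pE: "\<And>w v w' v'. p w = Some v \<Longrightarrow> p w' = Some v' \<Longrightarrow> (w, w') \<in> F \<Longrightarrow> (v, v') \<in> E"
      and qF: "\<And>w v w' v'. q v = Some w \<Longrightarrow> q v' = Some w' \<Longrightarrow> (v, v') \<in> E \<Longrightarrow> (w, w') \<in> F"
      using s unfolding good_def pq by (auto simp only: prod.case)
    \<comment> \<open>Images of the in-neighbours of \<open>w\<close>, and in \<open>O'\<close> of
      its out-neighbours. The edges of \<open>v\<close> are prescribed exactly: those present let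
      \<open>p\<close> extend, those absent let \<open>q\<close> extend.\<close>
    define I where "I = {v. \<exists>h. p h = Some v \<and> (h, w) \<in> F}"
    define O' where "O' = {v. \<exists>h. p h = Some v \<and> (w, h) \<in> F}"
    have "I \<subseteq> dom q" "O' \<subseteq> dom q" using pqinv by (auto simp: I_def O'_def)
    then obtain v where v: "v \<in> V" "v \<notin> dom q"
      "\<And>s. s \<in> dom q \<Longrightarrow> (s, v) \<in> E \<longleftrightarrow> s \<in> I" "\<And>s. s \<in> dom q \<Longrightarrow> (v, s) \<in> E \<longleftrightarrow> s \<in> O'"
      using universal_digraph_extension[OF U G(1,2), of I O'] by blast
    have pw: "p w = None" using False pq by auto
    have qv: "q v = None" using v(2) by auto
    have pv: "v' \<noteq> v" if "p w' = Some v'" for w' v' using pqinv[OF that] qv by auto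
    have I: "(v', v) \<in> E \<longleftrightarrow> (w', w) \<in> F" if "p w' = Some v'" for w' v'
      using v(3)[of v'] pqinv[OF that] that by (auto simp: I_def dom_def dest: pqinv)
    have O: "(v, v') \<in> E \<longleftrightarrow> (w, w') \<in> F" if "p w' = Some v'" for w' v'
      using v(4)[of v'] pqinv[OF that] that by (auto simp: O'_def dom_def dest: pqinv)
    have I': "(w', w) \<in> F" if "q v' = Some w'" "(v', v) \<in> E" for w' v'
      using v(3)[of v'] that by (auto simp: I_def dom_def dest!: pqinv)
    have O'': "(w, w') \<in> F" if "q v' = Some w'" "(v, v') \<in> E" for w' v'
      using v(4)[of v'] that by (auto simp: O'_def dom_def dest!: pqinv)
    have "good (p(w \<mapsto> v), q(v \<mapsto> w))"
      unfolding good_def prod.case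
    proof (intro conjI allI impI)
      show "ran (q(v \<mapsto> w)) \<subseteq> W" using G(3) w qv by (auto simp: ran_def)
    next
      fix w1 v1 assume "(p(w \<mapsto> v)) w1 = Some v1"
      then show "(q(v \<mapsto> w)) v1 = Some w1"
        using pqinv pv by (auto split: if_splits)
    next
      fix w1 v1 w2 v2
      assume "(p(w \<mapsto> v)) w1 = Some v1" "(p(w \<mapsto> v)) w2 = Some v2" "(w1, w2) \<in> F"
      then show "(v1, v2) \<in> E" using pE I O irrF by (auto split: if_splits)
    next
      fix w1 v1 w2 v2
      assume "(q(v \<mapsto> w)) v1 = Some w1" "(q(v \<mapsto> w)) v2 = Some w2" "(v1, v2) \<in> E"
      then show "(w1, w2) \<in> F" using qF I' O'' irrE by (auto split: if_splits)
    qed (use G v in auto)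
    moreover have "le s (p(w \<mapsto> v), q(v \<mapsto> w))"
      using pw qv by (auto simp: le_def pq map_le_def)
    ultimately show ?thesis by (intro exI[of _ "(p(w \<mapsto> v), q(v \<mapsto> w))"]) auto
  qed
  have extV: "\<exists>t. good t \<and> le s t \<and> v \<in> dom (snd t)" if s: "good s" and v: "v \<in> V" for s v
  proof (cases "v \<in> dom (snd s)")
    case True
    then show ?thesis using s by (intro exI[of _ s]) (auto simp: le_def map_le_def)
  next
    case False
    obtain p q where pq: "s = (p, q)" by fastforce
    have G: "finite (dom q)" "dom q \<subseteq> V" "ran q \<subseteq> W" and pqinv: "\<And>w v. p w = Some v \<Longrightarrow> q v = Some w"
      and pE: "\<And>w v w' v'. p w = Some v \<Longrightarrow> p w' = Some v' \<Longrightarrow> (w, w') \<in> F \<Longrightarrow> (v, v') \<in> E"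
      and qF: "\<And>w v w' v'. q v = Some w \<Longrightarrow> q v' = Some w' \<Longrightarrow> (v, v') \<in> E \<Longrightarrow> (w, w') \<in> F"
      using s unfolding good_def pq by (auto simp only: prod.case)
    have qv: "q v = None" using False pq by auto
    have "finite (ran q)" using G(1) by (rule finite_ran)
    then obtain w where w: "w \<in> W" "\<forall>x\<in>ran q. (x, w) \<in> F \<and> (w, x) \<in> F"
      using W(3) G(3) unfolding alg_closed_def by blast
    have w': "(x, w) \<in> F" "(w, x) \<in> F" if "q y = Some x" for x y
      using w(2) that by (auto simp: ran_def)
    have "good (p, q(v \<mapsto> w))"
      unfolding good_def prod.case
    proof (intro conjI allI impI)
      show "ran (q(v \<mapsto> w)) \<subseteq> W" using G(3) w qv by (auto simp: ran_def)
    next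
      fix w1 v1 assume "p w1 = Some v1"
      then show "(q(v \<mapsto> w)) v1 = Some w1"
        using pqinv[of w1 v1] qv by auto
    next
      fix w1 v1 w2 v2
      assume "(q(v \<mapsto> w)) v1 = Some w1" "(q(v \<mapsto> w)) v2 = Some w2" "(v1, v2) \<in> E"
      then show "(w1, w2) \<in> F" using qF w' irrE by (auto split: if_splits)
    qed (use G v pE in auto)
    moreover have "le s (p, q(v \<mapsto> w))"
      using qv by (auto simp: le_def pq map_le_def)
    ultimately show ?thesis by (intro exI[of _ "(p, q(v \<mapsto> w))"]) auto
  qed
  have V: "countable V" using U by (simp add: universal_digraph_def)
  have le_trans: "le r t" if "le r s" "le s t" for r s t
    using that unfolding le_def by (auto intro: map_le_trans split: prod.splits)
  have "V \<noteq> {}" "W \<noteq> {}"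
    using W(3) universal_digraph_alg_closed[OF U] by (force simp: alg_closed_def)+
  note fromV = range_from_nat_into[OF this(1) V] and fromW = range_from_nat_into[OF this(2) W(1)]
  \<comment> \<open>Stage \<open>n\<close> puts the \<open>n\<close>-th vertex of either digraph
    into the domain of its map, so both unions are total.\<close>
  have "\<exists>st. \<forall>n. good (st n) \<and> le (st n) (st (Suc n)) \<and>
      from_nat_into W n \<in> dom (fst (st (Suc n))) \<and> from_nat_into V n \<in> dom (snd (st (Suc n)))"
  proof -
    have "\<exists>st. \<forall>n. good (st n) \<and> (le (st n) (st (Suc n)) \<and>
      from_nat_into W n \<in> dom (fst (st (Suc n))) \<and> from_nat_into V n \<in> dom (snd (st (Suc n))))"
    proof (rule dependent_nat_choice)
      have "good (Map.empty, Map.empty)" by (auto simp: good_def)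
      then show "\<exists>s. good s" by blast
    next
      fix s n assume "good s"
      obtain t where t: "good t" "le s t" "from_nat_into W n \<in> dom (fst t)"
        using extW[OF \<open>good s\<close>] fromW by blast
      obtain r where r: "good r" "le t r" "from_nat_into V n \<in> dom (snd r)"
        using extV[OF t(1)] fromV by blast
      have "dom (fst t) \<subseteq> dom (fst r)"
        using r(2) by (auto simp: le_def split: prod.splits dest!: map_le_implies_dom_le)
      then show "\<exists>r. good r \<and> le s r \<and> from_nat_into W n \<in> dom (fst r) \<and> from_nat_into V n \<in> dom (snd r)"
        using t r le_trans by blast
    qed
    then show ?thesis by blast
  qed
  then obtain st where st: "\<And>n. good (st n)" "\<And>n. le (st n) (st (Suc n))"
    "\<And>n. from_nat_into W n \<in> dom (fst (st (Suc n)))" "\<And>n. from_nat_into V n \<in> dom (snd (st (Suc n)))"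
    by blast
  define P where "P n = fst (st n)" for n
  define Q where "Q n = snd (st n)" for n
  have good: "good (P n, Q n)" for n using st(1) by (simp add: P_def Q_def)
  have step: "P n \<subseteq>\<^sub>m P (Suc n)" "Q n \<subseteq>\<^sub>m Q (Suc n)" for n
    using st(2)[of n] by (auto simp: P_def Q_def le_def split: prod.splits)
  have monoP: "P m w = Some v \<Longrightarrow> m \<le> n \<Longrightarrow> P n w = Some v" for m n w v
  proof (induction n rule: nat_induct)
    case (Suc n)
    then show ?case using step(1)[of n]
      by (cases "m = Suc n") (auto simp: map_le_def dom_def le_Suc_eq)
  qed simp
  have monoQ: "Q m w = Some v \<Longrightarrow> m \<le> n \<Longrightarrow> Q n w = Some v" for m n w v
  proof (induction n rule: nat_induct)
    case (Suc n)
    then show ?case using step(2)[of n]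
      by (cases "m = Suc n") (auto simp: map_le_def dom_def le_Suc_eq)
  qed simp
  have exP: "\<exists>n v. P n w = Some v" if w: "w \<in> W" for w
  proof -
    obtain n where "w = from_nat_into W n" using fromW w by (metis imageE)
    then show ?thesis using st(3)[of n] by (auto simp: P_def)
  qed
  have exQ: "\<exists>n w. Q n v = Some w" if v: "v \<in> V" for v
  proof -
    obtain n where "v = from_nat_into V n" using fromV v by (metis imageE)
    then show ?thesis using st(4)[of n] by (auto simp: Q_def)
  qed
  obtain NP \<phi> where \<phi>: "\<And>w. w \<in> W \<Longrightarrow> P (NP w) w = Some (\<phi> w)" using exP by metis
  obtain NQ \<psi> where \<psi>: "\<And>v. v \<in> V \<Longrightarrow> Q (NQ v) v = Some (\<psi> v)" using exQ by metis
  have \<phi>': "P n w = Some (\<phi> w)" if "w \<in> W" "NP w \<le> n" for w n using monoP \<phi> that by blast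
  have \<psi>': "Q n v = Some (\<psi> v)" if "v \<in> V" "NQ v \<le> n" for v n using monoQ \<psi> that by blast
  have inv: "Q (NP w) (\<phi> w) = Some w" if "w \<in> W" for w
    using good[of "NP w"] \<phi>[OF that] by (auto simp: good_def)
  then have \<phi>V: "\<phi> w \<in> V" if "w \<in> W" for w
    using good[of "NP w"] that by (auto simp: good_def)
  have \<psi>W: "\<psi> v \<in> W" if "v \<in> V" for v
    using good[of "NQ v"] \<psi>[OF that] by (auto simp: good_def ran_def)
  show thesis
  proof
    show "digraph_hom W F V E \<phi>"
      unfolding digraph_hom_def
    proof (intro conjI ballI impI)
      fix u v assume uv: "u \<in> W" "v \<in> W" "(u, v) \<in> F"
      let ?n = "max (NP u) (NP v)"
      show "(\<phi> u, \<phi> v) \<in> E"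
        using good[of ?n] \<phi>'[OF uv(1), of ?n] \<phi>'[OF uv(2), of ?n] uv(3)
        unfolding good_def prod.case by (meson max.cobounded1 max.cobounded2)
    qed (use \<phi>V in auto)
    show "digraph_hom V E W F \<psi>"
      unfolding digraph_hom_def
    proof (intro conjI ballI impI)
      fix u v assume uv: "u \<in> V" "v \<in> V" "(u, v) \<in> E"
      let ?n = "max (NQ u) (NQ v)"
      show "(\<psi> u, \<psi> v) \<in> F"
        using good[of ?n] \<psi>'[OF uv(1), of ?n] \<psi>'[OF uv(2), of ?n] uv(3)
        unfolding good_def prod.case by (meson max.cobounded1 max.cobounded2)
    qed (use \<psi>W in auto)
    show "\<psi> (\<phi> w) = w" if w: "w \<in> W" for w
    proof -
      \<comment> \<open>At this stage \<open>Q\<close> is defined at \<open>\<phi> w\<close> for two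
        reasons: as the inverse of \<open>P\<close>, with value \<open>w\<close>, and by the choice
        of \<open>\<psi>\<close>.\<close>
      let ?n = "max (NP w) (NQ (\<phi> w))"
      have "Q ?n (\<phi> w) = Some w" using monoQ[OF inv[OF w]] by simp
      moreover have "Q ?n (\<phi> w) = Some (\<psi> (\<phi> w))" using \<psi>'[OF \<phi>V[OF w]] by simp
      ultimately show ?thesis by simp
    qed
  qed
qed

text \<open>On the image of \<open>\<phi>\<close> the map \<open>\<psi>\<close> is a homomorphic
  inverse, hence \<open>\<phi>\<close> reflects edges as well as preserving them and is an
  isomorphism onto the induced digraph.\<close>

lemma retract_idempotent:
  assumes \<phi>: "digraph_hom W F V E \<phi>" and \<psi>: "digraph_hom V E W F \<psi>"
    and inv: "\<And>w. w \<in> W \<Longrightarrow> \<psi> (\<phi> w) = w"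
  defines "e \<equiv> restrict (\<phi> \<circ> \<psi>) V"
  shows "e \<in> idempotents (End_digraph V E)"
    and "digraph_iso W F (e ` V) (image_edges V E e) \<phi>"
proof -
  have V: "\<phi> w \<in> V" if "w \<in> W" for w using \<phi> that by (auto simp: digraph_hom_def)
  have W: "\<psi> v \<in> W" if "v \<in> V" for v using \<psi> that by (auto simp: digraph_hom_def)
  have im: "e ` V = \<phi> ` W"
  proof
    show "e ` V \<subseteq> \<phi> ` W" using W by (auto simp: e_def)
    have "\<phi> w = e (\<phi> w)" if "w \<in> W" for w using inv V that by (simp add: e_def)
    then show "\<phi> ` W \<subseteq> e ` V" using V by blast
  qed
  have "e \<in> carrier (End_digraph V E)"
    unfolding e_def by (intro restrict_in_End digraph_hom_comp[OF \<psi> \<phi>])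
  then show "e \<in> idempotents (End_digraph V E)"
    using V inv by (simp add: idempotents_End_iff im) (simp add: e_def)
  have "digraph_hom W F (\<phi> ` W) (Restr E (\<phi> ` W)) \<phi>"
    using \<phi> by (auto simp: digraph_hom_def)
  moreover have "digraph_hom (\<phi> ` W) (Restr E (\<phi> ` W)) W F \<psi>"
    using V W \<psi> by (auto simp: digraph_hom_def)
  ultimately show "digraph_iso W F (e ` V) (image_edges V E e) \<phi>"
    unfolding im by (rule digraph_iso_if_inverse_homs) (use inv in auto)
qed

section \<open>Counting group H-classes\<close>

text \<open>Replacing every vertex of the image by two non-adjacent copies yields a digraph which retracts
  onto a copy of the image in continuum many ways, one for each choice of copies.\<close>

lemma many_idempotents_with_iso_image:
  assumes U: "universal_digraph V E" and e: "e \<in> idempotents (End_digraph V E)"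
  obtains f :: "nat set \<Rightarrow> 'a \<Rightarrow> 'a" where "inj f" "\<And>A. f A \<in> idempotents (End_digraph V E)"
    "\<And>A. \<exists>\<theta>. digraph_iso (e ` V) (image_edges V E e) (f A ` V) (image_edges V E (f A)) \<theta>"
proof -
  let ?I = "e ` V" and ?E = "image_edges V E e"
  have dV: "digraph V E" and cV: "countable V" using U by (auto simp: universal_digraph_def)
  have dI: "digraph ?I ?E" using dV by (auto simp: digraph_def irrefl_def)
  have ac: "alg_closed ?I ?E"
    using alg_closed_image[OF e] universal_digraph_alg_closed[OF U] .
  obtain \<iota> :: "nat \<Rightarrow> 'a" where \<iota>: "inj \<iota>" "range \<iota> \<subseteq> ?I"
    using alg_closed_infinite[OF dI ac] infinite_countable_subset by blast
  define W where "W = ?I \<times> (UNIV :: bool set)"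
  define F where "F = {(x :: 'a \<times> bool, y :: 'a \<times> bool). (fst x, fst y) \<in> ?E}"
  have "countable W" using cV by (auto simp: W_def)
  moreover have "digraph W F" using dI by (auto simp: digraph_def irrefl_def W_def F_def)
  moreover have "alg_closed W F"
    unfolding alg_closed_def
  proof (intro allI impI)
    fix S assume S: "finite S \<and> S \<subseteq> W"
    have "fst s \<in> ?I" if "s \<in> S" for s
      using S that unfolding W_def by (metis SigmaE fst_conv subsetD)
    then have "finite (fst ` S) \<and> fst ` S \<subseteq> ?I" using S by blast
    then have "\<exists>v\<in>?I. \<forall>s\<in>fst ` S. (s, v) \<in> ?E \<and> (v, s) \<in> ?E"
      by (rule ac[unfolded alg_closed_def, rule_format])
    then obtain v where v: "v \<in> ?I" "\<forall>s\<in>fst ` S. (s, v) \<in> ?E \<and> (v, s) \<in> ?E" ..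
    show "\<exists>v\<in>W. \<forall>s\<in>S. (s, v) \<in> F \<and> (v, s) \<in> F"
    proof (intro bexI[of _ "(v, True)"] ballI)
      show "(v, True) \<in> W" using v(1) by (simp add: W_def)
      show "(s, (v, True)) \<in> F \<and> ((v, True), s) \<in> F" if "s \<in> S" for s
        using v(2) that by (simp add: F_def)
    qed
  qed
  ultimately obtain \<phi> \<psi> where \<phi>: "digraph_hom W F V E \<phi>" and \<psi>: "digraph_hom V E W F \<psi>"
    and inv: "\<And>w. w \<in> W \<Longrightarrow> \<psi> (\<phi> w) = w"
    using alg_closed_retract[OF U] by metis
  \<comment> \<open>The copy \<open>True\<close> is taken at the vertices \<open>\<iota> n\<close>
    with \<open>n \<in> A\<close>, the copy \<open>False\<close> elsewhere. Every choice of copies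
    is a homomorphism because \<open>F\<close> looks at first components only.\<close>
  define s where "s A = (\<lambda>x. (x, x \<in> \<iota> ` A))" for A
  define f where "f A = restrict ((\<phi> \<circ> s A) \<circ> (fst \<circ> \<psi>)) V" for A
  have s: "digraph_hom ?I ?E V E (\<phi> \<circ> s A)" for A
    using \<phi> by (intro digraph_hom_comp[of _ _ W F]) (auto simp: digraph_hom_def W_def F_def s_def)
  have r: "digraph_hom V E ?I ?E (fst \<circ> \<psi>)"
    using \<psi> by (intro digraph_hom_comp[of _ _ W F]) (auto simp: digraph_hom_def W_def F_def)
  have rs: "(fst \<circ> \<psi>) ((\<phi> \<circ> s A) w) = w" if "w \<in> ?I" for w A
    using that inv[of "s A w"] by (simp add: W_def s_def)
  have \<phi>V: "\<phi> w \<in> V" if "w \<in> W" for w using \<phi> that by (auto simp: digraph_hom_def)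
  have "inj f"
  proof (rule injI)
    fix A B assume AB: "f A = f B"
    have "n \<in> A \<longleftrightarrow> n \<in> B" for n
    proof -
      have nW: "(\<iota> n, b) \<in> W" for b using \<iota> by (auto simp: W_def)
      \<comment> \<open>Applying \<open>f C\<close> to one copy of \<open>\<iota> n\<close> and
        decoding the result by \<open>\<psi>\<close> reveals which copy the section for
        \<open>C\<close> has chosen.\<close>
      have "\<psi> (f C (\<phi> (\<iota> n, True))) = (\<iota> n, \<iota> n \<in> \<iota> ` C)" for C
        using inv[OF nW] \<phi>V[OF nW] by (simp add: f_def s_def)
      then have "\<iota> n \<in> \<iota> ` A \<longleftrightarrow> \<iota> n \<in> \<iota> ` B" using AB by (metis prod.inject)
      then show ?thesis using \<iota>(1) by (simp add: inj_image_mem_iff)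
    qed
    then show "A = B" by blast
  qed
  then show thesis
    using retract_idempotent[OF s r rs] unfolding f_def[symmetric] by (intro that) blast+
qed

section \<open>Continuum many rigid extensions of a graph\<close>

text \<open>The one-way edges of the ray are exactly those from \<open>i\<close> to \<open>i + 1\<close>, which makes the ray rigid;
  the set \<open>A\<close> is recorded by the pairs \<open>i\<close>, \<open>i + 2\<close>.\<close>

definition ray_edge :: "nat set \<Rightarrow> nat \<Rightarrow> nat \<Rightarrow> bool" where
  "ray_edge A i j \<longleftrightarrow> i \<noteq> j \<and> i \<noteq> Suc j \<and> \<not> (j = i + 2 \<and> i \<in> A) \<and> \<not> (i = j + 2 \<and> j \<in> A)"

definition join_ray :: "'b set \<Rightarrow> 'b rel \<Rightarrow> nat set \<Rightarrow> ('b + nat) rel" where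
  "join_ray W F A = map_prod Inl Inl ` F \<union> {(Inl u, Inr i) | u i. u \<in> W} \<union>
     {(Inr i, Inl u) | u i. u \<in> W} \<union> {(Inr i, Inr j) | i j. ray_edge A i j}"

lemma join_ray_simps [simp]:
  "(Inl u, Inl v) \<in> join_ray W F A \<longleftrightarrow> (u, v) \<in> F"
  "(Inl u, Inr i) \<in> join_ray W F A \<longleftrightarrow> u \<in> W"
  "(Inr i, Inl u) \<in> join_ray W F A \<longleftrightarrow> u \<in> W"
  "(Inr i, Inr j) \<in> join_ray W F A \<longleftrightarrow> ray_edge A i j"
  by (auto simp: join_ray_def)

abbreviation ray_verts :: "'b set \<Rightarrow> ('b + nat) set" where
  "ray_verts W \<equiv> W <+> UNIV"

lemma digraph_join_ray: "digraph W F \<Longrightarrow> digraph (ray_verts W) (join_ray W F A)"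
  by (auto simp: digraph_def irrefl_def join_ray_def ray_edge_def)

lemma alg_closed_join_ray: "alg_closed (ray_verts W) (join_ray W F A)"
  unfolding alg_closed_def
proof (intro allI impI)
  fix S :: "('a + nat) set" assume S: "finite S \<and> S \<subseteq> ray_verts W"
  then have "finite (Inr -` S :: nat set)" by (intro finite_vimageI) auto
  then obtain n where n: "\<And>i. Inr i \<in> S \<Longrightarrow> i < n"
    by (metis finite_nat_set_iff_bounded vimageI2)
  \<comment> \<open>Ray vertices in \<open>S\<close> lie below \<open>n\<close>, and two distinct
    ray vertices can fail to be joined both ways only at distance one or two.\<close>
  have "(s, Inr (n + 3)) \<in> join_ray W F A \<and> (Inr (n + 3), s) \<in> join_ray W F A" if "s \<in> S" for s
    using S n that by (cases s) (fastforce simp: ray_edge_def)+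
  then show "\<exists>v\<in>ray_verts W. \<forall>s\<in>S. (s, v) \<in> join_ray W F A \<and> (v, s) \<in> join_ray W F A"
    by (intro bexI[of _ "Inr (n + 3)"]) auto
qed

text \<open>Edges in \<open>F\<close> and edges between graph and ray run both ways, and the pairs
  recorded by \<open>A\<close> lose both directions. Orientation alone thus singles out the
  successor relation of the ray.\<close>

lemma one_way_join_ray:
  assumes "sym F" "x \<in> ray_verts W" "y \<in> ray_verts W"
  shows "(x, y) \<in> join_ray W F A \<and> (y, x) \<notin> join_ray W F A \<longleftrightarrow>
     (\<exists>i. x = Inr i \<and> y = Inr (Suc i))"
  using assms by (cases x; cases y) (auto simp: ray_edge_def dest: symD)

text \<open>An isomorphism preserves one-way edges, so it commutes with the successor along the ray.
  The start of the ray is fixed because it has a one-way edge out and none in.\<close>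

lemma join_ray_iso_fixes_ray:
  assumes F: "sym F"
    and h: "digraph_iso (ray_verts W) (join_ray W F A) (ray_verts W) (join_ray W F B) h"
  shows "h (Inr i) = Inr i"
proof -
  have b: "bij_betw h (ray_verts W) (ray_verts W)" using h by (simp add: digraph_iso_def)
  have hV: "h x \<in> ray_verts W" if "x \<in> ray_verts W" for x using b that by (auto simp: bij_betw_def)
  have ow: "(\<exists>i. x = Inr i \<and> y = Inr (Suc i)) \<longleftrightarrow> (\<exists>i. h x = Inr i \<and> h y = Inr (Suc i))"
    if "x \<in> ray_verts W" "y \<in> ray_verts W" for x y
    using h that one_way_join_ray[OF F that, of A] one_way_join_ray[OF F hV hV, of x y B]
    by (simp add: digraph_iso_def)
  have suc: "\<exists>j. h (Inr i) = Inr j \<and> h (Inr (Suc i)) = Inr (Suc j)" for i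
    using ow[of "Inr i" "Inr (Suc i)"] by auto
  show ?thesis
  proof (induction i)
    case 0
    obtain j where j: "h (Inr 0) = Inr j" using suc by blast
    show ?case
    proof (cases j)
      \<comment> \<open>The preimage \<open>x\<close> of the predecessor \<open>Inr k\<close> would
        have a one-way edge into the start of the ray.\<close>
      case (Suc k)
      obtain x where x: "x \<in> ray_verts W" "h x = Inr k"
        using b by (auto simp: bij_betw_def) (metis InrI UNIV_I imageE)
      then show ?thesis using ow[of x "Inr 0"] j Suc by auto
    qed (use j in simp)
  next
    case (Suc i)
    then show ?case using suc[of i] by auto
  qed
qed

text \<open>With the ray fixed pointwise, the edge from \<open>i\<close> to \<open>i + 2\<close> is
  an invariant, and it is missing exactly when \<open>i\<close> belongs to the coded set.\<close>

lemma join_ray_iso_imp_eq: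
  assumes F: "sym F"
    and h: "digraph_iso (ray_verts W) (join_ray W F A) (ray_verts W) (join_ray W F B) h"
  shows "A = B"
proof -
  have "i \<in> A \<longleftrightarrow> i \<in> B" for i
  proof -
    have "ray_edge A i (i + 2) \<longleftrightarrow> ray_edge B i (i + 2)"
      using h join_ray_iso_fixes_ray[OF F h] unfolding digraph_iso_def
      by (metis InrI UNIV_I join_ray_simps(4))
    then show ?thesis by (simp add: ray_edge_def)
  qed
  then show ?thesis by blast
qed

text \<open>Automorphisms fix the ray pointwise, so they permute the vertices of the graph among
  themselves and \<open>projl\<close> always meets an \<open>Inl\<close>. Conversely, an
  automorphism of the graph extends by the identity on the ray, since every ray vertex is joined to
  all of \<open>W\<close>.\<close>

lemma Aut_join_ray:
  assumes F: "sym F"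
  shows "Aut_digraph (ray_verts W) (join_ray W F A) \<cong> Aut_digraph W F"
proof -
  let ?V = "ray_verts W" and ?E = "join_ray W F A"
  let ?G = "Aut_digraph ?V ?E" and ?A = "Aut_digraph W F"
  define res where "res h = restrict (\<lambda>w. projl (h (Inl w))) W" for h :: "'a + nat \<Rightarrow> 'a + nat"
  define lft where "lft \<alpha> = restrict (map_sum \<alpha> id) ?V" for \<alpha> :: "'a \<Rightarrow> 'a"
  have Gb: "bij_betw h ?V ?V" and GE: "\<And>x y. x \<in> ?V \<Longrightarrow> y \<in> ?V \<Longrightarrow> (x, y) \<in> ?E \<longleftrightarrow> (h x, h y) \<in> ?E"
    and Gr: "\<And>i. h (Inr i) = Inr i" if "h \<in> carrier ?G" for h
    using that join_ray_iso_fixes_ray[OF F, of W A A h]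
    by (auto simp: Aut_digraph_def digraph_iso_def)
  have Gl: "h (Inl w) = Inl (res h w) \<and> res h w \<in> W" if h: "h \<in> carrier ?G" and w: "w \<in> W" for h w
  proof (cases "h (Inl w)")
    case (Inl u)
    have "h (Inl w) \<in> ?V" using Gb[OF h] w by (auto simp: bij_betw_def)
    then show ?thesis using Inl w by (auto simp: res_def)
  next
    case (Inr i)
    then have "h (Inl w) = h (Inr i)" using Gr[OF h] by simp
    then have "Inl w = (Inr i :: 'a + nat)"
      using Gb[OF h] w by (auto simp: bij_betw_def inj_on_def)
    then show ?thesis by simp
  qed
  have res: "res h \<in> carrier ?A" if h: "h \<in> carrier ?G" for h
  proof -
    have "bij_betw (res h) W W"
      unfolding bij_betw_def
    proof
      show "inj_on (res h) W"
      proof (rule inj_onI)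
        fix x y assume xy: "x \<in> W" "y \<in> W" "res h x = res h y"
        then have "h (Inl x) = h (Inl y)" using Gl[OF h] by simp
        then show "x = y" using Gb[OF h] xy by (auto simp: bij_betw_def inj_on_def)
      qed
      show "res h ` W = W"
      proof
        show "res h ` W \<subseteq> W" using Gl[OF h] by auto
        show "W \<subseteq> res h ` W"
        proof
          fix w assume "w \<in> W"
          then obtain x where x: "x \<in> ?V" "h x = Inl w"
            using Gb[OF h] by (metis InlI bij_betw_def imageE)
          then obtain u where "x = Inl u" "u \<in> W" using Gr[OF h] by (cases x) auto
          then show "w \<in> res h ` W" using x Gl[OF h, of u] by auto
        qed
      qed
    qed
    moreover have "(u, v) \<in> F \<longleftrightarrow> (res h u, res h v) \<in> F" if "u \<in> W" "v \<in> W" for u v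
      using GE[OF h, of "Inl u" "Inl v"] Gl[OF h] that by auto
    moreover have "res h \<in> extensional W" by (simp add: res_def)
    ultimately show ?thesis by (simp add: Aut_digraph_def digraph_iso_def)
  qed
  have lft: "lft \<alpha> \<in> carrier ?G" if \<alpha>: "\<alpha> \<in> carrier ?A" for \<alpha>
  proof -
    have iso: "digraph_iso W F W F \<alpha>" using \<alpha> by (simp add: Aut_digraph_def)
    have b: "bij_betw \<alpha> W W" using iso by (simp add: digraph_iso_def)
    have \<alpha>W: "\<alpha> w \<in> W" if "w \<in> W" for w using b that by (auto simp: bij_betw_def)
    have "inj_on (lft \<alpha>) ?V"
    proof (rule inj_onI)
      fix x y assume "x \<in> ?V" "y \<in> ?V" "lft \<alpha> x = lft \<alpha> y"
      then show "x = y"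
        using inj_onD[OF bij_betw_imp_inj_on[OF b]]
        by (cases x; cases y) (auto simp: lft_def)
    qed
    moreover have "lft \<alpha> ` ?V = ?V"
    proof
      show "lft \<alpha> ` ?V \<subseteq> ?V" using \<alpha>W by (auto simp: lft_def)
      show "?V \<subseteq> lft \<alpha> ` ?V"
      proof
        fix x assume x: "x \<in> ?V"
        show "x \<in> lft \<alpha> ` ?V"
        proof (cases x)
          case (Inl w)
          then obtain u where "u \<in> W" "w = \<alpha> u" using x b by (auto simp: bij_betw_def)
          then show ?thesis using Inl by (intro image_eqI[of _ _ "Inl u"]) (auto simp: lft_def)
        next
          case (Inr i)
          then show ?thesis by (intro image_eqI[of _ _ "Inr i"]) (auto simp: lft_def)
        qed
      qed
    qed
    moreover have "(x, y) \<in> ?E \<longleftrightarrow> (lft \<alpha> x, lft \<alpha> y) \<in> ?E" if "x \<in> ?V" "y \<in> ?V" for x y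
      using that iso \<alpha>W by (cases x; cases y) (auto simp: lft_def digraph_iso_def)
    moreover have "lft \<alpha> \<in> extensional ?V" by (simp add: lft_def)
    ultimately show ?thesis by (simp add: Aut_digraph_def digraph_iso_def bij_betw_def)
  qed
  have "bij_betw res (carrier ?G) (carrier ?A)"
  proof (intro bij_betwI[where g = lft])
    show "lft (res h) = h" if "h \<in> carrier ?G" for h
    proof (rule extensionalityI[where A = ?V])
      show "h \<in> extensional ?V" using that by (simp add: Aut_digraph_def)
      show "lft (res h) x = h x" if "x \<in> ?V" for x
        using that Gl[OF \<open>h \<in> carrier ?G\<close>] Gr[OF \<open>h \<in> carrier ?G\<close>] by (auto simp: lft_def)
    qed (simp add: lft_def)
    show "res (lft \<alpha>) = \<alpha>" if "\<alpha> \<in> carrier ?A" for \<alpha>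
    proof (rule extensionalityI[where A = W])
      show "\<alpha> \<in> extensional W" using that by (simp add: Aut_digraph_def)
    qed (auto simp: res_def lft_def)
  qed (use res lft in auto)
  moreover have "res \<in> hom ?G ?A"
  proof (rule homI)
    fix g h assume gh: "g \<in> carrier ?G" "h \<in> carrier ?G"
    show "res (g \<otimes>\<^bsub>?G\<^esub> h) = res g \<otimes>\<^bsub>?A\<^esub> res h"
    proof (rule extensionalityI[where A = W])
      fix w assume w: "w \<in> W"
      have "h (g (Inl w)) = Inl (res h (res g w))" using Gl gh w by metis
      moreover have "res (g \<otimes>\<^bsub>?G\<^esub> h) w = projl (h (g (Inl w)))"
        using w InlI[OF w, where B = "UNIV :: nat set"] by (simp add: Aut_digraph_def compose_def res_def)
      moreover have "(res g \<otimes>\<^bsub>?A\<^esub> res h) w = res h (res g w)"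
        using w by (simp add: Aut_digraph_def compose_def)
      ultimately show "res (g \<otimes>\<^bsub>?G\<^esub> h) w = (res g \<otimes>\<^bsub>?A\<^esub> res h) w" by simp
    qed (auto simp: res_def Aut_digraph_def compose_def)
  qed (use res in auto)
  ultimately show ?thesis by (auto simp: is_iso_def iso_def)
qed

section \<open>Counting regular \<D>-classes and their group \<H>-classes\<close>

theorem theorem4p5:
  fixes V :: "'a set" and E :: "'a rel"
  assumes "universal_digraph V E"
  shows "(\<forall>(W :: 'b set) F. countable W \<and> ugraph W F \<longrightarrow>
            {X \<in> regular_D_classes (End_digraph V E).
               \<forall>e \<in> idempotents (End_digraph V E). green_H (End_digraph V E) `` {e} \<subseteq> X \<longrightarrow>
                 H_group (End_digraph V E) e \<cong> Aut_digraph W F}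
            \<approx> (UNIV :: nat set set)) \<and>
         (\<forall>X \<in> regular_D_classes (End_digraph V E).
            {H \<in> group_H_classes (End_digraph V E). H \<subseteq> X} \<approx> (UNIV :: nat set set))"
proof (intro conjI allI ballI impI)
  let ?M = "End_digraph V E"
  interpret monoid ?M by (rule monoid_End_digraph)
  have End_le: "carrier ?M \<lesssim> (UNIV :: nat set set)"
    using assms by (intro End_digraph_lepoll) (simp add: universal_digraph_def)
  {
    fix W :: "'b set" and F
    assume "countable W \<and> ugraph W F"
    then have W: "countable W" "digraph W F" "sym F" by (auto simp: ugraph_def)
    let ?X = "{X \<in> regular_D_classes ?M. \<forall>e \<in> idempotents ?M. green_H ?M `` {e} \<subseteq> X \<longrightarrow>
                 H_group ?M e \<cong> Aut_digraph W F}"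
    have "\<exists>e \<theta>. e \<in> idempotents ?M \<and>
        digraph_iso (ray_verts W) (join_ray W F A) (e ` V) (image_edges V E e) \<theta>" for A
    proof -
      have "countable (ray_verts W)" using W(1) by simp
      then obtain \<phi> \<psi> where "digraph_hom (ray_verts W) (join_ray W F A) V E \<phi>"
          "digraph_hom V E (ray_verts W) (join_ray W F A) \<psi>"
          "\<And>w. w \<in> ray_verts W \<Longrightarrow> \<psi> (\<phi> w) = w"
        using alg_closed_retract[OF assms _ digraph_join_ray[OF W(2)] alg_closed_join_ray] by metis
      from retract_idempotent[OF this] show ?thesis by blast
    qed
    then obtain e \<theta> where e: "\<And>A. e A \<in> idempotents ?M"
      and \<theta>: "\<And>A. digraph_iso (ray_verts W) (join_ray W F A) (e A ` V) (image_edges V E (e A)) (\<theta> A)"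
      by metis
    have ec: "e A \<in> carrier ?M" for A using e by (simp add: idempotents_def)
    \<comment> \<open>Every idempotent in the \<D>-class of \<open>e A\<close> has the joined
      digraph for \<open>A\<close> as its image. This separates the classes, since that digraph
      determines \<open>A\<close>, and it identifies all group \<H>-classes inside one
      class.\<close>
    have iso: "\<exists>h. digraph_iso (f ` V) (image_edges V E f) (ray_verts W) (join_ray W F A) h"
      if f: "f \<in> idempotents ?M" and D: "(e A, f) \<in> green_D ?M" for f A
    proof -
      obtain h where "digraph_iso (e A ` V) (image_edges V E (e A)) (f ` V) (image_edges V E f) h"
        using green_D_imp_image_iso[OF e f D] by blast
      then show ?thesis using digraph_iso_comp[OF \<theta>] digraph_iso_inv_into by blast
    qed
    have "inj (\<lambda>A. green_D ?M `` {e A})"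
    proof (rule injI)
      fix A B assume "green_D ?M `` {e A} = green_D ?M `` {e B}"
      then have "(e A, e B) \<in> green_D ?M" using green_D_refl[OF ec] by blast
      then obtain h where
        "digraph_iso (e B ` V) (image_edges V E (e B)) (ray_verts W) (join_ray W F A) h"
        using iso[OF e] by blast
      then have "B = A"
        using join_ray_iso_imp_eq[OF W(3)] digraph_iso_comp[OF \<theta>] by blast
      then show "A = B" by simp
    qed
    moreover have "green_D ?M `` {e A} \<in> ?X" for A
    proof -
      have "regular_elem ?M (e A)"
        using ec[of A] e[of A] unfolding regular_elem_def idempotents_def by force
      then have "green_D ?M `` {e A} \<in> regular_D_classes ?M"
        using ec[of A] green_D_regular by (auto simp: regular_D_classes_def quotient_def)
      moreover have "H_group ?M f \<cong> Aut_digraph W F"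
        if f: "f \<in> idempotents ?M" and "green_H ?M `` {f} \<subseteq> green_D ?M `` {e A}" for f
      proof -
        have "(e A, f) \<in> green_D ?M"
          using that green_H_refl[of f] by (auto simp: idempotents_def)
        then obtain h where
          "digraph_iso (f ` V) (image_edges V E f) (ray_verts W) (join_ray W F A) h"
          using iso[OF f] by blast
        from H_group_iso_Aut_image[OF f] Aut_digraph_iso[OF this] Aut_join_ray[OF W(3)]
        show ?thesis by (meson iso_trans)
      qed
      ultimately show ?thesis by simp
    qed
    ultimately have "(UNIV :: nat set set) \<lesssim> ?X"
      unfolding lepoll_def by (intro exI[of _ "\<lambda>A. green_D ?M `` {e A}"]) auto
    moreover have "?X \<subseteq> (\<lambda>f. green_D ?M `` {f}) ` carrier ?M"
      by (auto simp: regular_D_classes_def quotient_def)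
    then have "?X \<lesssim> (UNIV :: nat set set)"
      by (meson End_le image_lepoll lepoll_trans subset_imp_lepoll)
    ultimately show "?X \<approx> (UNIV :: nat set set)" by (simp add: lepoll_antisym)
  }
  {
    fix X assume X: "X \<in> regular_D_classes ?M"
    let ?X = "{H \<in> group_H_classes ?M. H \<subseteq> X}"
    obtain g where g: "g \<in> carrier ?M" "X = green_D ?M `` {g}" "\<forall>f\<in>X. regular_elem ?M f"
      using X by (auto simp: regular_D_classes_def quotient_def)
    then have "regular_elem ?M g" using green_D_refl by blast
    then obtain e where e: "e \<in> idempotents ?M" and L: "(g, e) \<in> green_L ?M"
      using regular_green_L_idempotent by blast
    obtain f :: "nat set \<Rightarrow> 'a \<Rightarrow> 'a" where f: "inj f" "\<And>A. f A \<in> idempotents ?M"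
      "\<And>A. \<exists>\<theta>. digraph_iso (e ` V) (image_edges V E e) (f A ` V) (image_edges V E (f A)) \<theta>"
      using many_idempotents_with_iso_image[OF assms e] by blast
    have fc: "f A \<in> carrier ?M" for A using f(2) by (simp add: idempotents_def)
    have "green_H ?M `` {f A} \<in> ?X" for A
    proof -
      have "(e, f A) \<in> green_D ?M" using image_iso_imp_green_D[OF e f(2)] f(3) by blast
      then obtain x where x: "(e, x) \<in> green_L ?M" "(x, f A) \<in> green_R ?M"
        by (auto simp: green_D_def)
      \<comment> \<open>The \<L>-steps from \<open>g\<close> through \<open>e\<close> to
        \<open>x\<close> merge into one, and so do the \<R>-steps from \<open>x\<close> through
        \<open>f A\<close> to \<open>h\<close>; the whole \<H>-class of \<open>f A\<close> thus lies
        in the \<D>-class of \<open>g\<close>.\<close>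
      have "(g, h) \<in> green_D ?M" if "(f A, h) \<in> green_H ?M" for h
        using that green_L_trans[OF L x(1)] green_R_trans[OF x(2)]
        by (auto simp: green_D_def green_H_def)
      then show ?thesis using f(2) g(2) by (auto simp: group_H_classes_def)
    qed
    moreover have "inj (\<lambda>A. green_H ?M `` {f A})"
    proof (rule injI)
      fix A B assume "green_H ?M `` {f A} = green_H ?M `` {f B}"
      then have "(f A, f B) \<in> green_H ?M" using green_H_refl[OF fc] by blast
      then show "A = B" using green_H_idempotents_eq[OF f(2) f(2)] f(1) by (auto dest: injD)
    qed
    ultimately have "(UNIV :: nat set set) \<lesssim> ?X"
      unfolding lepoll_def by (intro exI[of _ "\<lambda>A. green_H ?M `` {f A}"]) auto
    moreover have "?X \<subseteq> (\<lambda>f. green_H ?M `` {f}) ` carrier ?M"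
      by (auto simp: group_H_classes_def idempotents_def)
    then have "?X \<lesssim> (UNIV :: nat set set)"
      by (meson End_le image_lepoll lepoll_trans subset_imp_lepoll)
    ultimately show "?X \<approx> (UNIV :: nat set set)" by (simp add: lepoll_antisym)
  }
qed

end
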